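(* For all integers $m,d\ge1$, $$Z_{U_{m,d}}(x)\prec Z_{U_{m,d+1}}(x).$$
   Context: $U_{m,d}$ denotes the uniform matroid of rank $d$ and corank $m$, i.e. the uniform matroid of rank $d$ on $m+d$ elements. For a matroid $M$, let $L(M)$ be its lattice of flats, $\operatorname{rk}$ its rank function, $M|F$ the restriction to a flat $F$ and $M/F$ the contraction by $F$. Let $\chi_{M|F}(x)=\sum_{G\in L(M),\,G\subseteq F}\mu(\hat 0,G)\,x^{\operatorname{rk}F-\operatorname{rk}G}$ be the characteristic polynomial, with $\mu$ the Möbius function of $L(M)$ and $\hat 0$ its minimum. The Kazhdan--Lusztig polynomial $P_M(x)\in\mathbb Z[x]$ depends only on $L(M)$ and is the unique assignment such that: $P_M(x)=1$ if $\operatorname{rk}M=0$; $\deg P_M<\tfrac12\operatorname{rk}M$ if $\operatorname{rk}M>0$; and $x^{\operatorname{rk}M}P_M(x^{-1})=\sum_{F\in L(M)}\chi_{M|F}(x)P_{M/F}(x)$ for every $M$. The $Z$-polynomial is $Z_M(x)=\sum_{F\in L(M)}x^{\operatorname{rk}F}P_{M/F}(x)$. Interlacing convention: let $P,Q$ be nonzero real-rooted polynomials with positive leading coefficients and degrees $q$ and $r\in\{q,q+1\}$, with roots (counted with multiplicity) $a_1\le\cdots\le a_q$ and $b_1\le\cdots\le b_r$ respectively. Write $P\preccurlyeq Q$ if $a_1\le b_1\le a_2\le b_2\le\cdots\le a_q\le b_q$ when $r=q$, or $b_1\le a_1\le b_2\le\cdots\le b_q\le a_q\le b_{q+1}$ when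 $r=q+1$ (for $q=0$ these are the empty chain and the single-term chain $b_1$). Write $P\prec Q$ if $P\preccurlyeq Q$, all the inequalities in the chain are strict, and $P$ and $Q$ have no common root. (Thus $P\prec Q$ includes the assertion that both polynomials are real-rooted.) *)

theory Defs
  imports "HOL-Computational_Algebra.Polynomial" "HOL-Library.Multiset"
begin

section \<open>Finite matroids\<close>

definition is_matroid :: "'a set \<Rightarrow> 'a set set \<Rightarrow> bool" where
  "is_matroid E \<I> \<longleftrightarrow>
     finite E \<and> \<I> \<subseteq> Pow E \<and> {} \<in> \<I> \<and>
     (\<forall>I\<in>\<I>. \<forall>J. J \<subseteq> I \<longrightarrow> J \<in> \<I>) \<and>
     (\<forall>I\<in>\<I>. \<forall>J\<in>\<I>. card I < card J \<longrightarrow> (\<exists>x\<in>J - I. insert x I \<in> \<I>))"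

text \<open>Pairs of a ground set and a collection of independent sets.\<close>

typedef 'a matroid = "{(E :: 'a set, \<I>). is_matroid E \<I>}"
  by (rule exI[of _ "({}, {{}})"]) (auto simp: is_matroid_def)

setup_lifting type_definition_matroid

lift_definition ground :: "'a matroid \<Rightarrow> 'a set" is fst .

lift_definition indeps :: "'a matroid \<Rightarrow> 'a set set" is snd .

definition rank_of :: "'a matroid \<Rightarrow> 'a set \<Rightarrow> nat" where
  "rank_of M A = Max (card ` {I \<in> indeps M. I \<subseteq> A})"

abbreviation rank :: "'a matroid \<Rightarrow> nat" where
  "rank M \<equiv> rank_of M (ground M)"

definition flats :: "'a matroid \<Rightarrow> 'a set set" where
  "flats M = {F. F \<subseteq> ground M \<and> (\<forall>x\<in>ground M - F. rank_of M F < rank_of M (insert x F))}"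

definition basis_in :: "'a set set \<Rightarrow> 'a set \<Rightarrow> 'a set \<Rightarrow> bool" where
  "basis_in \<I> A B \<longleftrightarrow> B \<in> \<I> \<and> B \<subseteq> A \<and> (\<forall>x\<in>A - B. insert x B \<notin> \<I>)"

text \<open>The contraction \<open>M/A\<close>, with ground set \<open>E - A\<close>; its independent sets do not depend
  on which basis \<open>B\<close> of \<open>A\<close> is used.\<close>

lift_definition contract :: "'a matroid \<Rightarrow> 'a set \<Rightarrow> 'a matroid" is
  "\<lambda>(E, \<I>) A. (E - A, {I. I \<subseteq> E - A \<and> (\<exists>B. basis_in \<I> A B \<and> I \<union> B \<in> \<I>)})"
proof -
  fix p :: "'a set \<times> 'a set set" and A :: "'a set"
  obtain E \<I> where p: "p = (E, \<I>)" by fastforce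
  assume "p \<in> {(E, \<I>). is_matroid E \<I>}"
  then have "is_matroid E \<I>" unfolding p by simp
  then have fin: "finite E" and sub: "\<I> \<subseteq> Pow E" and emp: "{} \<in> \<I>"
    and down: "\<And>I J. I \<in> \<I> \<Longrightarrow> J \<subseteq> I \<Longrightarrow> J \<in> \<I>"
    and aug: "\<And>I J. I \<in> \<I> \<Longrightarrow> J \<in> \<I> \<Longrightarrow> card I < card J \<Longrightarrow> \<exists>x\<in>J - I. insert x I \<in> \<I>"
    unfolding is_matroid_def by blast+
  have finI: "finite I" if "I \<in> \<I>" for I
    using that sub fin by (meson PowD finite_subset subsetD)
  define \<J> where "\<J> = {I. I \<subseteq> E - A \<and> (\<exists>B. basis_in \<I> A B \<and> I \<union> B \<in> \<I>)}"
  have "\<exists>B. basis_in \<I> A B"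
  proof -
    have "finite {I \<in> \<I>. I \<subseteq> A}" using fin sub
      by (intro finite_subset[of "{I \<in> \<I>. I \<subseteq> A}" "Pow E"]) auto
    moreover have "{} \<in> {I \<in> \<I>. I \<subseteq> A}" using emp by simp
    ultimately obtain B where "B \<in> {I \<in> \<I>. I \<subseteq> A}"
      and max: "\<forall>C\<in>{I \<in> \<I>. I \<subseteq> A}. B \<subseteq> C \<longrightarrow> B = C"
      using finite_has_maximal[of "{I \<in> \<I>. I \<subseteq> A}"] by blast
    then have B: "B \<in> \<I>" "B \<subseteq> A" by auto
    have "insert x B \<notin> \<I>" if "x \<in> A - B" for x
      using B max that by auto
    then show ?thesis using B unfolding basis_in_def by auto
  qed
  then have J_emp: "{} \<in> \<J>" unfolding \<J>_def basis_in_def by auto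
  have J_down: "J \<in> \<J>" if I: "I \<in> \<J>" and J: "J \<subseteq> I" for I J
  proof -
    obtain B where B: "basis_in \<I> A B" "I \<union> B \<in> \<I>" "I \<subseteq> E - A" using I unfolding \<J>_def by auto
    then have "J \<union> B \<in> \<I>" using J down[of "I \<union> B" "J \<union> B"] by blast
    then show ?thesis using B J unfolding \<J>_def by auto
  qed
  have basis_card: "card B \<le> card C" if bases: "basis_in \<I> A B" "basis_in \<I> A C" for B C
  proof (rule ccontr)
    assume "\<not> card B \<le> card C"
    then obtain x where "x \<in> B - C" "insert x C \<in> \<I>"
      using bases aug[of C B] unfolding basis_in_def by (meson not_le)
    then show False using bases unfolding basis_in_def by blast
  qed
  have J_aug: "\<exists>x\<in>J - I. insert x I \<in> \<J>" if I: "I \<in> \<J>" and J: "J \<in> \<J>" and less: "card I < card J" for I J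
  proof -
    obtain B where B: "basis_in \<I> A B" "I \<union> B \<in> \<I>" "I \<subseteq> E - A" using I unfolding \<J>_def by auto
    obtain C where C: "basis_in \<I> A C" "J \<union> C \<in> \<I>" "J \<subseteq> E - A" using J unfolding \<J>_def by auto
    have "card (I \<union> B) = card I + card B"
      using B finI by (intro card_Un_disjoint) (auto simp: basis_in_def)
    moreover have "card (J \<union> C) = card J + card C"
      using C finI by (intro card_Un_disjoint) (auto simp: basis_in_def)
    ultimately have "card (I \<union> B) < card (J \<union> C)" using less basis_card[OF B(1) C(1)] by linarith
    then obtain x where x: "x \<in> (J \<union> C) - (I \<union> B)" "insert x (I \<union> B) \<in> \<I>" using aug[OF B(2) C(2)] by blast
    have "x \<notin> C"
    proof
      assume "x \<in> C"
      then have "x \<in> A - B" using C x unfolding basis_in_def by auto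
      moreover have "insert x B \<in> \<I>" by (rule down[OF x(2)]) auto
      ultimately show False using B unfolding basis_in_def by blast
    qed
    then have "x \<in> J - I" using x by auto
    moreover have "insert x I \<subseteq> E - A" using \<open>x \<in> J - I\<close> B(3) C(3) by blast
    moreover have "insert x I \<union> B \<in> \<I>" using x(2) by simp
    ultimately show ?thesis using B(1) unfolding \<J>_def by blast
  qed
  have "\<J> \<subseteq> Pow (E - A)" unfolding \<J>_def by auto
  then have "is_matroid (E - A) \<J>"
    unfolding is_matroid_def using fin J_emp J_down J_aug by blast
  then show "(case p of (E, \<I>) \<Rightarrow> \<lambda>A. (E - A, {I. I \<subseteq> E - A \<and> (\<exists>B. basis_in \<I> A B \<and> I \<union> B \<in> \<I>)})) A
    \<in> {(E, \<I>). is_matroid E \<I>}"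
    unfolding p \<J>_def by simp
qed

text \<open>\<open>uniform_matroid m d\<close> is the uniform matroid of rank \<open>d\<close> and corank \<open>m\<close>.\<close>

lift_definition uniform_matroid :: "nat \<Rightarrow> nat \<Rightarrow> nat matroid" is
  "\<lambda>m d. ({..<m + d}, {I. I \<subseteq> {..<m + d} \<and> card I \<le> d})"
proof -
  fix m d :: nat
  define E where "E = {..<m + d}"
  have fin: "finite I" if "I \<subseteq> E" for I
    using that unfolding E_def by (rule finite_subset) simp
  have down: "card J \<le> d" if "I \<subseteq> E" "card I \<le> d" "J \<subseteq> I" for I J
    using that card_mono[OF fin] by (meson le_trans)
  have aug: "\<exists>x\<in>J - I. insert x I \<subseteq> E \<and> card (insert x I) \<le> d"
    if "I \<subseteq> E" "J \<subseteq> E" "card J \<le> d" "card I < card J" for I J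
  proof -
    have "\<not> J \<subseteq> I" using that card_mono[of I J] fin by auto
    then obtain x where x: "x \<in> J - I" by blast
    then have "card (insert x I) \<le> d" using that fin[of I] by simp
    then show ?thesis using x that by blast
  qed
  have "is_matroid E {I. I \<subseteq> E \<and> card I \<le> d}"
    unfolding is_matroid_def
  proof (intro conjI ballI allI impI)
    show "finite E" unfolding E_def by simp
    show "J \<in> {I. I \<subseteq> E \<and> card I \<le> d}"
      if "I \<in> {I. I \<subseteq> E \<and> card I \<le> d}" "J \<subseteq> I" for I J
      using that down[of I J] by blast
    show "\<exists>x\<in>J - I. insert x I \<in> {I. I \<subseteq> E \<and> card I \<le> d}"
      if "I \<in> {I. I \<subseteq> E \<and> card I \<le> d}" "J \<in> {I. I \<subseteq> E \<and> card I \<le> d}" "card I < card J" for I J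
      using that aug[of I J] by simp
  qed auto
  then show "({..<m + d}, {I. I \<subseteq> {..<m + d} \<and> card I \<le> d}) \<in> {(E, \<I>). is_matroid E \<I>}"
    unfolding E_def by simp
qed

section \<open>Kazhdan--Lusztig polynomials and Z-polynomials\<close>

text \<open>The Moebius function of a family \<open>L\<close> of finite sets, ordered by inclusion.\<close>

function mobius :: "'a set set \<Rightarrow> 'a set \<Rightarrow> 'a set \<Rightarrow> int" where
  "mobius L A B =
     (if A = B then 1
      else if A \<subset> B \<and> finite B then - (\<Sum>C\<in>{C\<in>L. A \<subseteq> C \<and> C \<subset> B}. mobius L A C)
      else 0)"
  by pat_completeness auto
termination
  by (relation "measure (\<lambda>(L, A, B). card B)") (auto intro: psubset_card_mono)

declare mobius.simps [simp del]

text \<open>The characteristic polynomial of the restriction of \<open>M\<close> to a flat \<open>F\<close>, expressed in the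
  lattice of flats of \<open>M\<close>, whose minimum is \<open>\<Inter>(flats M)\<close>.\<close>

definition restriction_char_poly :: "'a matroid \<Rightarrow> 'a set \<Rightarrow> int poly" where
  "restriction_char_poly M F =
     (\<Sum>G\<in>{G\<in>flats M. G \<subseteq> F}.
        monom (mobius (flats M) (\<Inter>(flats M)) G) (rank_of M F - rank_of M G))"

text \<open>\<open>x\<^sup>n p(x\<^sup>-\<^sup>1)\<close>, for \<open>degree p \<le> n\<close>.\<close>

definition reverse_poly :: "nat \<Rightarrow> int poly \<Rightarrow> int poly" where
  "reverse_poly n p = monom 1 (n - degree p) * reflect_poly p"

text \<open>The assignments satisfying the defining conditions of the Kazhdan--Lusztig polynomials, on
  the matroids with ground set in a given type; these are closed under contraction.\<close>

definition is_KL :: "('a matroid \<Rightarrow> int poly) \<Rightarrow> bool" where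
  "is_KL P \<longleftrightarrow>
     (\<forall>M. (rank M = 0 \<longrightarrow> P M = 1) \<and>
          (rank M > 0 \<longrightarrow> 2 * degree (P M) < rank M) \<and>
          reverse_poly (rank M) (P M) =
            (\<Sum>F\<in>flats M. restriction_char_poly M F * P (contract M F)))"

definition KL_poly :: "'a matroid \<Rightarrow> int poly" where
  "KL_poly = (THE P. is_KL P)"

definition Z_poly :: "'a matroid \<Rightarrow> int poly" where
  "Z_poly M = (\<Sum>F\<in>flats M. monom 1 (rank_of M F) * KL_poly (contract M F))"

section \<open>Interlacing\<close>

definition real_rooted :: "real poly \<Rightarrow> bool" where
  "real_rooted p \<longleftrightarrow> p \<noteq> 0 \<and> size (proots p) = degree p"

definition sorted_roots :: "real poly \<Rightarrow> real list" where
  "sorted_roots p = sorted_list_of_multiset (proots p)"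

text \<open>The chain \<open>a\<^sub>1, b\<^sub>1, a\<^sub>2, b\<^sub>2, \<dots>, a\<^sub>q, b\<^sub>q\<close>, respectively
  \<open>b\<^sub>1, a\<^sub>1, b\<^sub>2, \<dots>, b\<^sub>q, a\<^sub>q, b\<^sub>q\<^sub>+\<^sub>1\<close>, of the roots \<open>a\<^sub>i\<close> of \<open>p\<close> and \<open>b\<^sub>i\<close> of \<open>q\<close>;
  \<open>splice\<close> alternates between its two arguments.\<close>

definition root_chain :: "real poly \<Rightarrow> real poly \<Rightarrow> real list" where
  "root_chain p q =
     (if degree q = degree p then splice (sorted_roots p) (sorted_roots q)
      else splice (sorted_roots q) (sorted_roots p))"

definition interlaces :: "real poly \<Rightarrow> real poly \<Rightarrow> bool"  (infix \<open>\<preceq>\<close> 50) where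
  "p \<preceq> q \<longleftrightarrow>
     real_rooted p \<and> real_rooted q \<and> lead_coeff p > 0 \<and> lead_coeff q > 0 \<and>
     degree q \<in> {degree p, degree p + 1} \<and>
     sorted_wrt (\<le>) (root_chain p q)"

definition strictly_interlaces :: "real poly \<Rightarrow> real poly \<Rightarrow> bool"  (infix \<open>\<prec>\<close> 50) where
  "p \<prec> q \<longleftrightarrow>
     p \<preceq> q \<and> sorted_wrt (<) (root_chain p q) \<and> \<not> (\<exists>x. poly p x = 0 \<and> poly q x = 0)"

end

theory Submission
  imports Defs "HOL-Computational_Algebra.Formal_Power_Series"
begin

text \<open>
  The Kazhdan--Lusztig polynomials are characterised by the condition that all Z-polynomials are
  palindromic: palindromicity can be achieved by recursion on the rank, and Moebius inversion over
  the lattice of flats turns it into the defining identity (\<open>is_KL_KL_rec\<close>). Conversely, the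
  degree bound makes the solution of the defining identity unique (\<open>is_KL_unique\<close>). So the
  Z-polynomials of uniform matroids of a fixed corank can be identified by exhibiting palindromic
  polynomials whose inverse binomial transforms have degree less than half the rank
  (\<open>Z_poly_uniform_unique\<close>). For corank \<open>n + 1\<close> and rank \<open>D\<close> these are the polynomials
  \<open>\<Sum>i. \<gamma>\<^sub>i x\<^sup>i (1 + x)\<^bsup>D - 2 i\<^esup>\<close> with
  \<open>\<gamma>\<^sub>i = D! N\<^sub>D(i) / ((D - 2 i)! i! (i + n + 1)!)\<close>, where \<open>N\<^sub>D\<close> is a polynomial of degree \<open>n\<close> in
  \<open>i\<close>; the required vanishing of coefficients is a Vandermonde-type identity
  (\<open>zeta_upper_coeff_sum\<close>).

  The polynomial \<open>\<Sum>i. \<gamma>\<^sub>i y\<^sup>i\<close> results from applying \<open>N\<^sub>D (y d/dy)\<close> to a polynomial of Gegenbauer type,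
  which has simple negative roots because of its three-term recurrence. The values of \<open>N\<^sub>D\<close> at
  \<open>0, -1, \<dots>, -n\<close> alternate in sign, so \<open>N\<^sub>D\<close> has simple negative roots too, and each factor
  \<open>\<rho> + y d/dy\<close> with \<open>\<rho> > 0\<close> keeps the roots simple and negative (\<open>neg_simple_diag_linear\<close>).

  For interlacing it suffices that, at each root of the polynomial of rank \<open>d + 1\<close>, the polynomial of
  rank \<open>d\<close> has the sign of the derivative of the former (\<open>strictly_interlaces_criterion\<close>). The gamma
  polynomial of rank \<open>d\<close> arises from the Gegenbauer polynomial of rank \<open>d + 1\<close> with multiplier
  \<open>N\<^sub>d(i) (1 - 2 i / (d + 1))\<close>. The recurrence
  \<open>d N\<^bsub>d + 1\<^esub>(i) = (d - i) N\<^sub>d(i) + C i (i + 1) \<cdots> (i + n)\<close> with \<open>C > 0\<close> shows that all residues of the quotient of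
  this multiplier by \<open>N\<^bsub>d + 1\<^esub>\<close> are positive; so partial fractions write the gamma polynomial
  of rank \<open>d\<close> as a combination of polynomials with the required sign (\<open>diag_interlacing_sign\<close>). The
  substitution \<open>y = x / (1 + x)\<^sup>2\<close> carries the sign condition over to the Z-polynomials
  (\<open>zeta_interlacing_sign\<close>).
\<close>

section \<open>Rank, flats and contraction\<close>

lemma is_matroid_Rep: "is_matroid (ground M) (indeps M)"
  by transfer auto

lemma finite_ground [simp]: "finite (ground M)"
  using is_matroid_Rep[of M] by (simp add: is_matroid_def)

lemma indep_subset_ground: "I \<in> indeps M \<Longrightarrow> I \<subseteq> ground M"
  using is_matroid_Rep[of M] by (auto simp: is_matroid_def)

lemma empty_indep [simp]: "{} \<in> indeps M"
  using is_matroid_Rep[of M] by (simp add: is_matroid_def)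

lemma indep_mono: "I \<in> indeps M \<Longrightarrow> J \<subseteq> I \<Longrightarrow> J \<in> indeps M"
  using is_matroid_Rep[of M] by (auto simp: is_matroid_def)

lemma indep_augment:
  "I \<in> indeps M \<Longrightarrow> J \<in> indeps M \<Longrightarrow> card I < card J \<Longrightarrow> \<exists>x\<in>J - I. insert x I \<in> indeps M"
  using is_matroid_Rep[of M] by (auto simp: is_matroid_def)

lemma finite_indep: "I \<in> indeps M \<Longrightarrow> finite I"
  using indep_subset_ground finite_ground finite_subset by blast

lemma finite_indeps [simp]: "finite (indeps M)"
  by (rule finite_subset[of _ "Pow (ground M)"]) (auto dest: indep_subset_ground)

lemma matroid_eqI: "ground M = ground N \<Longrightarrow> indeps M = indeps N \<Longrightarrow> M = N"
  by transfer (auto simp: prod_eq_iff)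

lemma ground_contract: "ground (contract M A) = ground M - A"
  by transfer (auto split: prod.splits)

lemma indeps_contract:
  "indeps (contract M A) =
     {I. I \<subseteq> ground M - A \<and> (\<exists>B. basis_in (indeps M) A B \<and> I \<union> B \<in> indeps M)}"
  by transfer (auto split: prod.splits)

lemma rank_eq_card_basis:
  assumes "basis_in (indeps M) A B"
  shows "rank_of M A = card B"
proof -
  have "card I \<le> card B" if "I \<in> indeps M" "I \<subseteq> A" for I
    using indep_augment[of B M I] that assms unfolding basis_in_def
    by (metis DiffE DiffI leI subset_iff)
  then show ?thesis
    unfolding rank_of_def using assms
    by (intro Max_eqI) (auto simp: basis_in_def)
qed

lemma basis_extend:
  assumes "I \<in> indeps M" "I \<subseteq> A"
  obtains B where "I \<subseteq> B" "basis_in (indeps M) A B"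
proof -
  let ?S = "{J \<in> indeps M. J \<subseteq> A}"
  obtain B where B: "B \<in> ?S" "I \<subseteq> B" "\<forall>C\<in>?S. B \<subseteq> C \<longrightarrow> B = C"
    using finite_has_maximal2[of ?S I] assms by auto
  then have "basis_in (indeps M) A B" unfolding basis_in_def by auto
  then show ?thesis using B that by blast
qed

lemma card_le_rank: "I \<in> indeps M \<Longrightarrow> I \<subseteq> A \<Longrightarrow> card I \<le> rank_of M A"
  unfolding rank_of_def by (intro Max_ge) auto

lemma rank_witness:
  obtains I where "I \<in> indeps M" "I \<subseteq> A" "card I = rank_of M A"
proof -
  obtain B where "basis_in (indeps M) A B" using basis_extend[of "{}" M A] by auto
  then show ?thesis using that rank_eq_card_basis unfolding basis_in_def by metis
qed

lemma rank_mono: "A \<subseteq> B \<Longrightarrow> rank_of M A \<le> rank_of M B"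
proof -
  assume "A \<subseteq> B"
  obtain I where "I \<in> indeps M" "I \<subseteq> A" "card I = rank_of M A" by (rule rank_witness)
  then show ?thesis using card_le_rank[of I M B] \<open>A \<subseteq> B\<close> by simp
qed

lemma rank_le_card: "finite A \<Longrightarrow> rank_of M A \<le> card A"
proof -
  assume "finite A"
  obtain I where "I \<in> indeps M" "I \<subseteq> A" "card I = rank_of M A" by (rule rank_witness)
  then show ?thesis using card_mono[of A I] \<open>finite A\<close> by simp
qed

lemma indep_iff_rank:
  assumes "A \<subseteq> ground M"
  shows "A \<in> indeps M \<longleftrightarrow> rank_of M A = card A"
proof -
  have fin: "finite A" using assms by (rule finite_subset) simp
  have "rank_of M A = card A" if "A \<in> indeps M"
    using that card_le_rank[of A M A] rank_le_card[OF fin, of M] by simp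
  moreover have "A \<in> indeps M" if "rank_of M A = card A"
  proof -
    obtain I where "I \<in> indeps M" "I \<subseteq> A" "card I = rank_of M A" by (rule rank_witness)
    then show ?thesis using card_subset_eq[OF fin, of I] that by simp
  qed
  ultimately show ?thesis by blast
qed

text \<open>A basis \<open>B\<close> of \<open>A\<close> extends to a basis \<open>C\<close> of \<open>X \<union> A\<close> with \<open>C \<inter> A = B\<close>, and \<open>C - A\<close> is then a
  basis of \<open>X\<close> in the contraction. All further facts on contractions follow from this formula.\<close>

lemma rank_contract:
  assumes X: "X \<subseteq> ground M - A"
  shows "rank_of (contract M A) X + rank_of M A = rank_of M (X \<union> A)"
proof (rule antisym)
  obtain I where I: "I \<in> indeps (contract M A)" "I \<subseteq> X" "card I = rank_of (contract M A) X"
    by (rule rank_witness)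
  then obtain B where B: "basis_in (indeps M) A B" "I \<union> B \<in> indeps M" "I \<subseteq> ground M - A"
    unfolding indeps_contract by auto
  have "B \<subseteq> A" using B(1) by (simp add: basis_in_def)
  have "card (I \<union> B) = card I + card B"
    using B finite_indep[OF B(2)] \<open>B \<subseteq> A\<close> by (intro card_Un_disjoint) auto
  moreover have "card (I \<union> B) \<le> rank_of M (X \<union> A)"
    using B I \<open>B \<subseteq> A\<close> by (intro card_le_rank) auto
  ultimately show "rank_of (contract M A) X + rank_of M A \<le> rank_of M (X \<union> A)"
    using I rank_eq_card_basis[OF B(1)] by simp
next
  obtain B where B: "basis_in (indeps M) A B" using basis_extend[of "{}" M A] by auto
  then have BA: "B \<in> indeps M" "B \<subseteq> A" by (auto simp: basis_in_def)
  obtain C where C: "B \<subseteq> C" "basis_in (indeps M) (X \<union> A) C"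
    using basis_extend[of B M "X \<union> A"] BA by auto
  then have Ci: "C \<in> indeps M" "C \<subseteq> X \<union> A" by (auto simp: basis_in_def)
  have "C \<inter> A \<subseteq> B"
  proof (rule ccontr)
    assume "\<not> C \<inter> A \<subseteq> B"
    then obtain x where x: "x \<in> C" "x \<in> A - B" by auto
    then have "insert x B \<in> indeps M" using C by (intro indep_mono[OF Ci(1)]) auto
    then show False using B x unfolding basis_in_def by auto
  qed
  then have eq: "(C - A) \<union> B = C" using C BA by auto
  have "C - A \<in> indeps (contract M A)"
    unfolding indeps_contract using B eq Ci X by (auto intro!: exI[of _ B])
  then have "card (C - A) \<le> rank_of (contract M A) X"
    using Ci by (intro card_le_rank) auto
  moreover have "card C = card (C - A) + card B"
    using card_Un_disjoint[of "C - A" B] eq BA finite_indep Ci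
    by (metis Diff_disjoint Int_commute disjoint_iff finite_Diff subset_iff)
  ultimately show "rank_of M (X \<union> A) \<le> rank_of (contract M A) X + rank_of M A"
    using rank_eq_card_basis[OF B] rank_eq_card_basis[OF C(2)] by simp
qed

lemma indep_contract_iff:
  assumes "I \<subseteq> ground M - A"
  shows "I \<in> indeps (contract M A) \<longleftrightarrow> rank_of M (I \<union> A) = card I + rank_of M A"
  using indep_iff_rank[of I "contract M A"] rank_contract[OF assms] assms
  by (auto simp: ground_contract)

lemma contract_contract:
  assumes "A \<subseteq> ground M" "B \<subseteq> ground M - A"
  shows "contract (contract M A) B = contract M (A \<union> B)"
proof (rule matroid_eqI)
  show "ground (contract (contract M A) B) = ground (contract M (A \<union> B))"
    by (auto simp: ground_contract)
  have iff: "I \<in> indeps (contract (contract M A) B) \<longleftrightarrow> I \<in> indeps (contract M (A \<union> B))"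
    if "I \<subseteq> ground M - (A \<union> B)" for I
  proof -
    have "rank_of (contract M A) (I \<union> B) + rank_of M A = rank_of M (I \<union> B \<union> A)"
      using that assms by (intro rank_contract) auto
    moreover have "rank_of (contract M A) B + rank_of M A = rank_of M (B \<union> A)"
      using assms by (intro rank_contract) auto
    moreover have "I \<union> B \<union> A = I \<union> (A \<union> B)" "B \<union> A = A \<union> B" by auto
    moreover have "I \<in> indeps (contract (contract M A) B) \<longleftrightarrow>
        rank_of (contract M A) (I \<union> B) = card I + rank_of (contract M A) B"
      using that by (intro indep_contract_iff) (auto simp: ground_contract)
    ultimately show ?thesis
      using indep_contract_iff[OF that] by auto
  qed
  have 1: "I \<subseteq> ground M - (A \<union> B)" if "I \<in> indeps (contract (contract M A) B)" for I
    using indep_subset_ground[OF that] by (auto simp: ground_contract)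
  have 2: "I \<subseteq> ground M - (A \<union> B)" if "I \<in> indeps (contract M (A \<union> B))" for I
    using indep_subset_ground[OF that] by (simp add: ground_contract)
  show "indeps (contract (contract M A) B) = indeps (contract M (A \<union> B))"
    using iff 1 2 by (intro set_eqI iffI) metis+
qed

lemma flat_subset_ground: "F \<in> flats M \<Longrightarrow> F \<subseteq> ground M"
  by (simp add: flats_def)

lemma finite_flats [simp]: "finite (flats M)"
  by (rule finite_subset[of _ "Pow (ground M)"]) (auto simp: flats_def)

lemma finite_flat: "F \<in> flats M \<Longrightarrow> finite F"
  using flat_subset_ground finite_ground finite_subset by blast

lemma ground_flat [simp]: "ground M \<in> flats M"
  by (simp add: flats_def)

lemma flats_contract:
  assumes "F \<subseteq> ground M"
  shows "H \<in> flats (contract M F) \<longleftrightarrow> H \<subseteq> ground M - F \<and> F \<union> H \<in> flats M"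
proof (cases "H \<subseteq> ground M - F")
  case True
  have "rank_of (contract M F) H < rank_of (contract M F) (insert x H) \<longleftrightarrow>
      rank_of M (F \<union> H) < rank_of M (insert x (F \<union> H))" if "x \<in> ground M - F" for x
    using rank_contract[of H M F] rank_contract[of "insert x H" M F] that True
    by (auto simp: Un_ac)
  moreover have "ground (contract M F) - H = ground M - (F \<union> H)" "F \<union> H \<subseteq> ground M"
    using True assms by (auto simp: ground_contract)
  ultimately show ?thesis using True unfolding flats_def by (simp add: ground_contract)
qed (auto simp: flats_def ground_contract)

lemma bij_betw_flats_contract:
  assumes "F \<subseteq> ground M"
  shows "bij_betw (\<lambda>H. F \<union> H) (flats (contract M F)) {G \<in> flats M. F \<subseteq> G}"
proof (rule bij_betw_byWitness[where f' = "\<lambda>G. G - F"])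
  show "\<forall>H\<in>flats (contract M F). F \<union> H - F = H"
    using flats_contract[OF assms] by auto
  show "\<forall>G\<in>{G \<in> flats M. F \<subseteq> G}. F \<union> (G - F) = G" by auto
  show "(\<union>) F ` flats (contract M F) \<subseteq> {G \<in> flats M. F \<subseteq> G}"
    using flats_contract[OF assms] by auto
  show "(\<lambda>G. G - F) ` {G \<in> flats M. F \<subseteq> G} \<subseteq> flats (contract M F)"
    using flats_contract[OF assms] flat_subset_ground[of _ M] by (fastforce simp: Un_absorb1)
qed

definition loops :: "'a matroid \<Rightarrow> 'a set" where
  "loops M = {x \<in> ground M. rank_of M {x} = 0}"

lemma indep_Int_loops:
  assumes "I \<in> indeps M"
  shows "I \<inter> loops M = {}"
proof (rule ccontr)
  assume "I \<inter> loops M \<noteq> {}"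
  then obtain x where x: "x \<in> I" "rank_of M {x} = 0" by (auto simp: loops_def)
  then have "{x} \<in> indeps M" by (intro indep_mono[OF assms]) auto
  then show False using card_le_rank[of "{x}" M "{x}"] x by simp
qed

lemma rank_loops [simp]: "rank_of M (loops M) = 0"
proof -
  obtain I where "I \<in> indeps M" "I \<subseteq> loops M" "card I = rank_of M (loops M)"
    by (rule rank_witness)
  then show ?thesis using indep_Int_loops[of I M] by (simp add: Int_absorb2)
qed

lemma loops_flat [simp]: "loops M \<in> flats M"
proof -
  have "0 < rank_of M (insert x (loops M))" if "x \<in> ground M - loops M" for x
  proof -
    have "0 < rank_of M {x}" using that by (auto simp: loops_def)
    also have "\<dots> \<le> rank_of M (insert x (loops M))" by (rule rank_mono) auto
    finally show ?thesis .
  qed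
  moreover have "loops M \<subseteq> ground M" by (auto simp: loops_def)
  ultimately show ?thesis by (simp add: flats_def)
qed

lemma loops_subset_flat:
  assumes "F \<in> flats M"
  shows "loops M \<subseteq> F"
proof (rule ccontr)
  assume "\<not> loops M \<subseteq> F"
  then obtain x where x: "x \<in> loops M" "x \<notin> F" by auto
  obtain I where I: "I \<in> indeps M" "I \<subseteq> insert x F" "card I = rank_of M (insert x F)"
    by (rule rank_witness)
  have "x \<notin> I" using indep_Int_loops[OF I(1)] x by auto
  then have "card I \<le> rank_of M F" using I by (intro card_le_rank) auto
  moreover have "x \<in> ground M - F" using x by (auto simp: loops_def)
  then have "rank_of M F < rank_of M (insert x F)" using assms by (auto simp: flats_def)
  ultimately show False using I by simp
qed

lemma Inter_flats: "\<Inter>(flats M) = loops M"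
  using loops_flat loops_subset_flat by blast

lemma rank_flat_eq_0_iff:
  assumes "F \<in> flats M"
  shows "rank_of M F = 0 \<longleftrightarrow> F = loops M"
proof
  assume "rank_of M F = 0"
  then have "rank_of M {x} = 0" if "x \<in> F" for x
    using rank_mono[of "{x}" F M] that by simp
  then have "F \<subseteq> loops M"
    using flat_subset_ground[OF assms] unfolding loops_def by auto
  then show "F = loops M" using loops_subset_flat[OF assms] by auto
qed simp

lemma rank_le_ground: "rank_of M A \<le> rank M"
proof -
  obtain I where "I \<in> indeps M" "I \<subseteq> A" "card I = rank_of M A" by (rule rank_witness)
  then show ?thesis using card_le_rank[of I M "ground M"] indep_subset_ground by metis
qed

lemma rank_contract_flat:
  assumes "F \<in> flats M"
  shows "rank (contract M F) + rank_of M F = rank M"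
  using rank_contract[of "ground M - F" M F] flat_subset_ground[OF assms]
  by (simp add: Un_absorb2 ground_contract)

section \<open>Existence and uniqueness of the Kazhdan--Lusztig polynomials\<close>

lemma smult_sum_right: "smult c (\<Sum>x\<in>A. f x) = (\<Sum>x\<in>A. smult c (f x))"
  by (induction A rule: infinite_finite_induct) (simp_all add: smult_add_right)

lemma coeff_monom_mult':
  "coeff (monom (1 :: 'a :: comm_semiring_1) k * p) n = (if k \<le> n then coeff p (n - k) else 0)"
  by (simp add: coeff_monom_mult)

lemma coeff_reverse_poly:
  assumes "degree p \<le> n"
  shows "coeff (reverse_poly n p) i = (if i \<le> n then coeff p (n - i) else 0)"
proof -
  have "coeff p (n - i) = 0" if "i < n - degree p"
    by (rule coeff_eq_0) (use that in linarith)
  moreover have "degree p - (i - (n - degree p)) = n - i" if "n - degree p \<le> i"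
    using that assms by linarith
  ultimately show ?thesis
    unfolding reverse_poly_def coeff_monom_mult' coeff_reflect_poly using assms
    by (auto simp: not_le)
qed

lemma reverse_poly_sum:
  assumes "\<And>x. x \<in> A \<Longrightarrow> degree (f x) \<le> n"
  shows "reverse_poly n (\<Sum>x\<in>A. f x) = (\<Sum>x\<in>A. reverse_poly n (f x))"
proof (rule poly_eqI)
  fix i
  have "degree (\<Sum>x\<in>A. f x) \<le> n"
    using assms by (cases "finite A") (auto intro: degree_sum_le)
  then show "coeff (reverse_poly n (\<Sum>x\<in>A. f x)) i = coeff (\<Sum>x\<in>A. reverse_poly n (f x)) i"
    by (simp add: coeff_reverse_poly coeff_sum assms)
qed

lemma reverse_poly_monom_mult:
  assumes "degree p + k \<le> n"
  shows "reverse_poly n (monom 1 k * p) = reverse_poly (n - k) p"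
proof (rule poly_eqI)
  fix i
  have "degree (monom 1 k * p) \<le> n"
    using assms degree_mult_le[of "monom (1::int) k" p] degree_monom_le[of "1::int" k] by linarith
  moreover have "degree p \<le> n - k" using assms by simp
  ultimately show "coeff (reverse_poly n (monom 1 k * p)) i = coeff (reverse_poly (n - k) p) i"
    using assms by (auto simp: coeff_reverse_poly coeff_monom_mult' intro: arg_cong[where f = "coeff p"])
qed

text \<open>A polynomial of degree below \<open>r/2\<close> is determined by the requirement that adding it to a
  given polynomial \<open>w\<close> gives one whose coefficients read the same backwards from degree \<open>r\<close>:
  its coefficients must repair the asymmetry of the lower half of \<open>w\<close>.\<close>

definition symmetrizer :: "nat \<Rightarrow> int poly \<Rightarrow> int poly" where
  "symmetrizer r w = (\<Sum>i | 2 * i < r. monom (coeff w (r - i) - coeff w i) i)"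

lemma coeff_symmetrizer:
  "coeff (symmetrizer r w) i = (if 2 * i < r then coeff w (r - i) - coeff w i else 0)"
proof -
  have "finite {i. 2 * i < r}" by (rule finite_subset[of _ "{..r}"]) auto
  then show ?thesis by (simp add: symmetrizer_def coeff_sum coeff_monom)
qed

lemma degree_symmetrizer:
  assumes "r > 0"
  shows "2 * degree (symmetrizer r w) < r"
proof (rule ccontr)
  assume "\<not> ?thesis"
  then have "coeff (symmetrizer r w) (degree (symmetrizer r w)) = 0" "degree (symmetrizer r w) > 0"
    using assms by (auto simp: coeff_symmetrizer)
  then show False by (metis degree_0 leading_coeff_0_iff less_irrefl)
qed

lemma symmetrizer_palindromic:
  assumes "degree w \<le> r"
  shows "reverse_poly r (symmetrizer r w + w) = symmetrizer r w + w"
proof (rule poly_eqI)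
  fix i
  have "degree (symmetrizer r w) \<le> r"
    using degree_symmetrizer[of r w] by (cases "r = 0") (auto simp: symmetrizer_def)
  then have deg: "degree (symmetrizer r w + w) \<le> r" using assms by (simp add: degree_add_le)
  have "coeff w i = 0" if "i > r" using that assms by (simp add: coeff_eq_0)
  moreover have "r - (r - i) = i" if "i \<le> r" using that by simp
  moreover have "r - i = i" if "\<not> 2 * i < r" "\<not> 2 * (r - i) < r" "i \<le> r" using that by linarith
  ultimately show "coeff (reverse_poly r (symmetrizer r w + w)) i = coeff (symmetrizer r w + w) i"
    by (auto simp: coeff_reverse_poly[OF deg] coeff_symmetrizer)
qed

lemma palindromic_low_degree_eq_0:
  assumes "2 * degree p < r \<or> p = 0" and "reverse_poly r p = p"
  shows "p = 0"
proof (rule ccontr)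
  assume "p \<noteq> 0"
  then have deg: "2 * degree p < r" using assms by auto
  then have "coeff (reverse_poly r p) (degree p) = coeff p (r - degree p)"
    by (subst coeff_reverse_poly) auto
  also have "\<dots> = 0" using deg by (intro coeff_eq_0) auto
  finally show False using assms(2) \<open>p \<noteq> 0\<close> by simp
qed

text \<open>The conditions on degrees together with palindromicity of the Z-polynomial allow a recursion
  on the rank that always has a solution: at each rank, only the term of the flat of rank \<open>0\<close> in the
  Z-polynomial is still unknown, and it is chosen to make the sum palindromic.\<close>

function KL_rec :: "'a matroid \<Rightarrow> int poly" where
  "KL_rec M =
     (if rank M = 0 then 1
      else symmetrizer (rank M)
        (\<Sum>F\<in>{F \<in> flats M. rank_of M F > 0}. monom 1 (rank_of M F) * KL_rec (contract M F)))"
  by auto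
termination
proof (relation "measure rank")
  fix M :: "'a matroid" and F
  assume "F \<in> {F \<in> flats M. rank_of M F > 0}"
  then show "(contract M F, M) \<in> measure rank" using rank_contract_flat[of F M] by simp
qed simp

declare KL_rec.simps [simp del]

lemma KL_rec_rank_0: "rank M = 0 \<Longrightarrow> KL_rec M = 1"
  by (simp add: KL_rec.simps)

lemma degree_KL_rec: "rank M > 0 \<Longrightarrow> 2 * degree (KL_rec M) < rank M"
  by (subst KL_rec.simps) (simp add: degree_symmetrizer)

lemma degree_KL_rec_le: "degree (KL_rec M) \<le> rank M"
  using degree_KL_rec[of M] KL_rec_rank_0[of M] by (cases "rank M = 0") auto

lemma sum_flats_contract:
  assumes "F \<in> flats M"
  shows "(\<Sum>H\<in>flats (contract M F). f (rank_of (contract M F) H) (contract (contract M F) H)) =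
         (\<Sum>G\<in>{G \<in> flats M. F \<subseteq> G}. f (rank_of M G - rank_of M F) (contract M G))"
proof -
  have sub: "F \<subseteq> ground M" using assms by (rule flat_subset_ground)
  have "(\<Sum>H\<in>flats (contract M F). f (rank_of M (F \<union> H) - rank_of M F) (contract M (F \<union> H))) =
    (\<Sum>H\<in>flats (contract M F). f (rank_of (contract M F) H) (contract (contract M F) H))"
  proof (rule sum.cong[OF refl])
    fix H assume "H \<in> flats (contract M F)"
    then have H: "H \<subseteq> ground M - F" using flats_contract[OF sub] by simp
    then show "f (rank_of M (F \<union> H) - rank_of M F) (contract M (F \<union> H)) =
        f (rank_of (contract M F) H) (contract (contract M F) H)"
      using contract_contract[OF sub H] rank_contract[OF H]
      by (metis add_diff_cancel_right' Un_commute)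
  qed
  then show ?thesis
    using sum.reindex_bij_betw[OF bij_betw_flats_contract[OF sub],
      of "\<lambda>G. f (rank_of M G - rank_of M F) (contract M G)"] by simp
qed

lemma loops_contract_loops: "loops (contract M (loops M)) = {}"
proof -
  have "{} \<in> flats (contract M (loops M))"
    by (subst flats_contract) (auto simp: flat_subset_ground)
  then show ?thesis using loops_subset_flat by blast
qed

text \<open>The flat of rank \<open>0\<close> is the set of loops, so its term in the Z-polynomial belongs to
  \<open>M\<close> without its loops. Only flats of \<open>M\<close> and their contractions enter the recursion, and
  these are the same for both matroids.\<close>

lemma KL_rec_contract_loops: "KL_rec (contract M (loops M)) = KL_rec M"
proof -
  define N where "N = contract M (loops M)"
  have rank: "rank N = rank M" using rank_contract_flat[of "loops M" M] by (simp add: N_def)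
  have eq: "{G \<in> flats M. loops M \<subseteq> G} = flats M" using loops_subset_flat by blast
  let ?t = "\<lambda>k N. if k > 0 then monom 1 k * KL_rec N else 0"
  have "(\<Sum>F\<in>{F \<in> flats N. rank_of N F > 0}. monom 1 (rank_of N F) * KL_rec (contract N F)) =
      (\<Sum>F\<in>flats N. ?t (rank_of N F) (contract N F))"
    by (rule sum.mono_neutral_cong_left) auto
  also have "\<dots> = (\<Sum>G\<in>flats M. ?t (rank_of M G) (contract M G))"
    unfolding N_def using sum_flats_contract[of "loops M" M ?t] by (simp add: eq cong: if_cong)
  also have "\<dots> = (\<Sum>F\<in>{F \<in> flats M. rank_of M F > 0}. monom 1 (rank_of M F) * KL_rec (contract M F))"
    by (rule sum.mono_neutral_cong_right) auto
  finally show ?thesis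
    unfolding N_def[symmetric] by (subst (1 2) KL_rec.simps) (simp add: rank)
qed

definition Z_rec :: "'a matroid \<Rightarrow> int poly" where
  "Z_rec M = (\<Sum>F\<in>flats M. monom 1 (rank_of M F) * KL_rec (contract M F))"

lemma degree_KL_rec_contract:
  "F \<in> flats M \<Longrightarrow> degree (KL_rec (contract M F)) + rank_of M F \<le> rank M"
  using degree_KL_rec_le[of "contract M F"] rank_contract_flat[of F M] by simp

lemma Z_rec_palindromic: "reverse_poly (rank M) (Z_rec M) = Z_rec M"
proof (cases "rank M = 0")
  case True
  have "flats M = {loops M}"
  proof -
    have "F = loops M" if "F \<in> flats M" for F
      using rank_le_ground[of M F] rank_flat_eq_0_iff[OF that] True by simp
    then show ?thesis using loops_flat by blast
  qed
  then have "Z_rec M = 1"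
    using True by (simp add: Z_rec_def KL_rec_contract_loops KL_rec_rank_0)
  then show ?thesis using True by (simp add: reverse_poly_def)
next
  case False
  let ?S = "{F \<in> flats M. rank_of M F > 0}"
  let ?w = "\<Sum>F\<in>?S. monom 1 (rank_of M F) * KL_rec (contract M F)"
  have "flats M = insert (loops M) ?S" using rank_flat_eq_0_iff[of _ M] by auto
  then have "Z_rec M = (\<Sum>F\<in>insert (loops M) ?S. monom 1 (rank_of M F) * KL_rec (contract M F))"
    unfolding Z_rec_def by (simp only:)
  also have "\<dots> = KL_rec M + ?w"
    by (subst sum.insert) (simp_all add: KL_rec_contract_loops)
  also have "KL_rec M = symmetrizer (rank M) ?w" using False by (simp add: KL_rec.simps[of M])
  finally have "Z_rec M = symmetrizer (rank M) ?w + ?w" .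
  moreover have "degree ?w \<le> rank M"
  proof (rule degree_sum_le)
    fix F assume "F \<in> ?S"
    then show "degree (monom 1 (rank_of M F) * KL_rec (contract M F)) \<le> rank M"
      using degree_mult_le[of "monom (1::int) (rank_of M F)" "KL_rec (contract M F)"]
        degree_monom_le[of "1::int" "rank_of M F"] degree_KL_rec_contract[of F M] by simp
  qed simp
  ultimately show ?thesis by (simp add: symmetrizer_palindromic)
qed

lemma sum_mobius:
  assumes "A \<in> L" "G \<in> L" "A \<subseteq> G" "finite L" "finite G"
  shows "(\<Sum>C\<in>{C\<in>L. A \<subseteq> C \<and> C \<subseteq> G}. mobius L A C) = (if A = G then 1 else 0)"
proof (cases "A = G")
  case True
  then have "{C\<in>L. A \<subseteq> C \<and> C \<subseteq> G} = {G}" using assms by auto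
  then show ?thesis using True by (simp add: mobius.simps)
next
  case False
  have "{C\<in>L. A \<subseteq> C \<and> C \<subseteq> G} = insert G {C\<in>L. A \<subseteq> C \<and> C \<subset> G}" using assms by auto
  then show ?thesis using False assms by (simp add: mobius.simps[of L A G] psubset_eq)
qed

text \<open>Palindromicity of the Z-polynomial of each \<open>M/F\<close> writes it as the sum of the reversed
  polynomials of the flats above \<open>F\<close>; Moebius inversion over \<open>F\<close> isolates the reversed
  polynomial of \<open>M\<close>, and the Moebius sums that appear are the characteristic polynomials.\<close>

lemma is_KL_KL_rec: "is_KL KL_rec"
  unfolding is_KL_def
proof (intro allI conjI impI)
  fix M :: "'a matroid"
  define L where "L = flats M"
  define \<mu> where "\<mu> = mobius L (loops M)"
  define Q where "Q G = reverse_poly (rank (contract M G)) (KL_rec (contract M G))" for G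
  have finL: "finite L" by (simp add: L_def)
  have Z: "(\<Sum>G\<in>{G\<in>L. F \<subseteq> G}. Q G) =
      (\<Sum>G\<in>{G\<in>L. F \<subseteq> G}. monom 1 (rank_of M G - rank_of M F) * KL_rec (contract M G))"
    if F: "F \<in> L" for F
  proof -
    have F': "F \<in> flats M" using F by (simp add: L_def)
    have "Z_rec (contract M F) =
        (\<Sum>G\<in>{G\<in>L. F \<subseteq> G}. monom 1 (rank_of M G - rank_of M F) * KL_rec (contract M G))"
      unfolding Z_rec_def L_def
      by (rule sum_flats_contract[OF F', of "\<lambda>k N. monom 1 k * KL_rec N"])
    moreover have "reverse_poly (rank (contract M F)) (Z_rec (contract M F)) =
        (\<Sum>H\<in>flats (contract M F). reverse_poly (rank (contract (contract M F) H))
          (KL_rec (contract (contract M F) H)))"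
    proof -
      let ?N = "contract M F"
      have deg: "degree (KL_rec (contract ?N H)) + rank_of ?N H \<le> rank ?N"
        and rk: "rank ?N - rank_of ?N H = rank (contract ?N H)" if "H \<in> flats ?N" for H
        using degree_KL_rec_contract[OF that] rank_contract_flat[OF that] by linarith+
      have "reverse_poly (rank ?N) (Z_rec ?N) = (\<Sum>H\<in>flats ?N. reverse_poly (rank ?N)
          (monom 1 (rank_of ?N H) * KL_rec (contract ?N H)))"
        unfolding Z_rec_def
      proof (rule reverse_poly_sum)
        fix H assume "H \<in> flats ?N"
        then show "degree (monom 1 (rank_of ?N H) * KL_rec (contract ?N H)) \<le> rank ?N"
          using degree_mult_le[of "monom (1::int) (rank_of ?N H)" "KL_rec (contract ?N H)"]
            degree_monom_le[of "1::int" "rank_of ?N H"] deg[of H] by linarith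
      qed
      also have "\<dots> = (\<Sum>H\<in>flats ?N. reverse_poly (rank (contract ?N H)) (KL_rec (contract ?N H)))"
        by (rule sum.cong) (simp_all add: reverse_poly_monom_mult deg rk)
      finally show ?thesis .
    qed
    moreover have "\<dots> = (\<Sum>G\<in>{G\<in>L. F \<subseteq> G}. Q G)"
      unfolding Q_def L_def
      by (rule sum_flats_contract[OF F', of "\<lambda>k N. reverse_poly (rank N) (KL_rec N)"])
    ultimately show ?thesis using Z_rec_palindromic[of "contract M F"] by simp
  qed
  have bot: "loops M \<in> L" "\<And>G. G \<in> L \<Longrightarrow> loops M \<subseteq> G"
    unfolding L_def using loops_subset_flat by auto
  have swap: "(\<Sum>F\<in>L. \<Sum>G\<in>{G\<in>L. F \<subseteq> G}. f F G) = (\<Sum>G\<in>L. \<Sum>F\<in>{F\<in>L. F \<subseteq> G}. f F G)"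
    for f :: "'a set \<Rightarrow> 'a set \<Rightarrow> int poly"
    using sum.swap_restrict[OF finL finL, of f "\<lambda>F G. F \<subseteq> G"] by simp
  have "(\<Sum>F\<in>L. \<Sum>G\<in>{G\<in>L. F \<subseteq> G}. smult (\<mu> F) (Q G)) =
      (\<Sum>G\<in>L. smult (\<Sum>F\<in>{F\<in>L. F \<subseteq> G}. \<mu> F) (Q G))"
    unfolding swap smult_sum[symmetric] ..
  also have "\<dots> = (\<Sum>G\<in>L. if loops M = G then Q G else 0)"
  proof (rule sum.cong[OF refl])
    fix G assume G: "G \<in> L"
    have "{F\<in>L. F \<subseteq> G} = {C\<in>L. loops M \<subseteq> C \<and> C \<subseteq> G}" using bot by auto
    then show "smult (\<Sum>F\<in>{F\<in>L. F \<subseteq> G}. \<mu> F) (Q G) = (if loops M = G then Q G else 0)"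
      using sum_mobius[OF bot(1) G bot(2)[OF G] finL] G finite_flat[of G M]
      by (simp add: \<mu>_def L_def)
  qed
  also have "\<dots> = Q (loops M)" using bot finL by simp
  also have "\<dots> = reverse_poly (rank M) (KL_rec M)"
    unfolding Q_def using rank_contract_flat[of "loops M" M] by (simp add: KL_rec_contract_loops)
  finally have 1: "(\<Sum>F\<in>L. smult (\<mu> F) (\<Sum>G\<in>{G\<in>L. F \<subseteq> G}. Q G)) = reverse_poly (rank M) (KL_rec M)"
    by (simp add: smult_sum_right)
  have "(\<Sum>F\<in>L. smult (\<mu> F) (\<Sum>G\<in>{G\<in>L. F \<subseteq> G}. Q G)) =
      (\<Sum>F\<in>L. \<Sum>G\<in>{G\<in>L. F \<subseteq> G}. monom (\<mu> F) (rank_of M G - rank_of M F) * KL_rec (contract M G))"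
  proof (rule sum.cong[OF refl])
    fix F assume "F \<in> L"
    have "smult (\<mu> F) (monom 1 k * p) = monom (\<mu> F) k * p" for k p
      by (simp add: smult_monom flip: mult_smult_left)
    then show "smult (\<mu> F) (\<Sum>G\<in>{G\<in>L. F \<subseteq> G}. Q G) = (\<Sum>G\<in>{G\<in>L. F \<subseteq> G}.
        monom (\<mu> F) (rank_of M G - rank_of M F) * KL_rec (contract M G))"
      using \<open>F \<in> L\<close> by (simp only: Z smult_sum_right)
  qed
  also have "\<dots> = (\<Sum>G\<in>L. restriction_char_poly M G * KL_rec (contract M G))"
    unfolding swap unfolding restriction_char_poly_def Inter_flats \<mu>_def L_def sum_distrib_right ..
  finally show "reverse_poly (rank M) (KL_rec M) =
      (\<Sum>F\<in>flats M. restriction_char_poly M F * KL_rec (contract M F))"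
    using 1 by (simp add: L_def)
qed (simp_all add: KL_rec_rank_0 degree_KL_rec)

lemma restriction_char_poly_loops: "restriction_char_poly M (loops M) = 1"
proof -
  have "{G \<in> flats M. G \<subseteq> loops M} = {loops M}" using loops_subset_flat by auto
  then show ?thesis by (simp add: restriction_char_poly_def Inter_flats mobius.simps)
qed

text \<open>In the defining identity of a loopless matroid \<open>M\<close>, the term of the empty flat is the
  polynomial of \<open>M\<close> and all other terms belong to smaller ranks; a matroid with loops \<open>L\<close> only
  involves \<open>M/L\<close> and smaller ranks.\<close>

lemma is_KL_unique:
  assumes P: "is_KL P" and Q: "is_KL Q"
  shows "P M = Q M"
proof (induction "rank M" arbitrary: M rule: less_induct)
  case less
  have deg: "degree (P N) \<le> rank N" "degree (Q N) \<le> rank N" for N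
  proof -
    have "degree R \<le> n" if "n = 0 \<longrightarrow> R = 1" "n > 0 \<longrightarrow> 2 * degree R < n" for R :: "int poly" and n
      using that by (cases "n = 0") auto
    then show "degree (P N) \<le> rank N" "degree (Q N) \<le> rank N"
      using P Q unfolding is_KL_def by blast+
  qed
  have step: "reverse_poly (rank N) (P N) - reverse_poly (rank N) (Q N) =
      P (contract N (loops N)) - Q (contract N (loops N))" if rk: "rank N = rank M" for N
  proof -
    have eq: "P (contract N F) = Q (contract N F)" if "F \<in> flats N" "F \<noteq> loops N" for F
    proof (rule less)
      show "rank (contract N F) < rank M"
        using rank_contract_flat[OF that(1)] rank_flat_eq_0_iff[OF that(1)] that(2) rk by linarith
    qed
    have "reverse_poly (rank N) (P N) - reverse_poly (rank N) (Q N) =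
      (\<Sum>F\<in>flats N. restriction_char_poly N F * (P (contract N F) - Q (contract N F)))"
      using P Q unfolding is_KL_def by (simp add: right_diff_distrib sum_subtractf)
    also have "\<dots> = (\<Sum>F\<in>{loops N}. restriction_char_poly N F * (P (contract N F) - Q (contract N F)))"
      using eq by (intro sum.mono_neutral_right) auto
    finally show ?thesis by (simp add: restriction_char_poly_loops)
  qed
  have rev_diff: "reverse_poly (rank N) (P N) - reverse_poly (rank N) (Q N) =
      reverse_poly (rank N) (P N - Q N)" for N
    by (rule poly_eqI) (simp add: coeff_reverse_poly deg degree_diff_le)
  let ?N = "contract M (loops M)"
  have rk: "rank ?N = rank M" using rank_contract_flat[of "loops M" M] by simp
  \<comment> \<open>The identity for the loopless \<open>M/L\<close> involves the unknown polynomial on both sides.\<close>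
  have "contract ?N (loops ?N) = ?N"
    unfolding loops_contract_loops
    by (subst contract_contract) (auto simp: flat_subset_ground)
  then have "reverse_poly (rank ?N) (P ?N - Q ?N) = P ?N - Q ?N"
    using step[OF rk] rev_diff[of ?N] by simp
  moreover have "2 * degree (P ?N - Q ?N) < rank ?N \<or> P ?N - Q ?N = 0"
  proof (cases "rank ?N = 0")
    case True
    then show ?thesis using P Q unfolding is_KL_def by auto
  next
    case False
    then have "2 * degree (P ?N) < rank ?N" "2 * degree (Q ?N) < rank ?N"
      using P Q unfolding is_KL_def by auto
    then show ?thesis using degree_diff_le_max[of "P ?N" "Q ?N"] by linarith
  qed
  ultimately have "P ?N - Q ?N = 0" by (rule palindromic_low_degree_eq_0[rotated])
  then have "reverse_poly (rank M) (P M - Q M) = 0"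
    using step[of M] rev_diff[of M] by simp
  then have "P M - Q M = 0" by (auto simp: reverse_poly_def)
  then show ?case by simp
qed

lemma KL_poly_eq: "KL_poly = KL_rec"
  unfolding KL_poly_def using is_KL_KL_rec is_KL_unique by (intro the_equality ext) auto

lemma Z_poly_eq: "Z_poly = Z_rec"
  by (intro ext) (simp add: Z_poly_def Z_rec_def KL_poly_eq)

section \<open>Uniform matroids\<close>

text \<open>Contractions of uniform matroids are uniform, but on other ground sets; hence uniformity is
  treated as a property of a matroid.\<close>

definition is_uniform :: "nat \<Rightarrow> nat \<Rightarrow> 'a matroid \<Rightarrow> bool" where
  "is_uniform m d M \<longleftrightarrow>
     card (ground M) = m + d \<and> indeps M = {I. I \<subseteq> ground M \<and> card I \<le> d}"

lemma is_uniform_uniform_matroid: "is_uniform m d (uniform_matroid m d)"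
proof -
  have "ground (uniform_matroid m d) = {..<m + d}" by transfer simp
  moreover have "indeps (uniform_matroid m d) = {I. I \<subseteq> {..<m + d} \<and> card I \<le> d}"
    by transfer simp
  ultimately show ?thesis by (simp add: is_uniform_def)
qed

lemma rank_uniform:
  assumes "is_uniform m d M" "A \<subseteq> ground M"
  shows "rank_of M A = min (card A) d"
proof -
  have fin: "finite A" using assms(2) by (rule finite_subset) simp
  obtain B where B: "B \<subseteq> A" "card B = min (card A) d"
    using obtain_subset_with_card_n[of "min (card A) d" A] by auto
  have "B \<in> indeps M" using B assms by (auto simp: is_uniform_def)
  then have "min (card A) d \<le> rank_of M A" using card_le_rank[of B M A] B by simp
  moreover obtain I where "I \<in> indeps M" "I \<subseteq> A" "card I = rank_of M A" by (rule rank_witness)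
  then have "rank_of M A \<le> d" using assms by (auto simp: is_uniform_def)
  ultimately show ?thesis using rank_le_card[OF fin, of M] by simp
qed

lemma flats_uniform:
  assumes M: "is_uniform m d M"
  shows "flats M = insert (ground M) {F. F \<subseteq> ground M \<and> card F < d}"
proof -
  have "F \<in> flats M \<longleftrightarrow> F = ground M \<or> card F < d" if F: "F \<subseteq> ground M" for F
  proof -
    have "rank_of M F < rank_of M (insert x F) \<longleftrightarrow> card F < d" if "x \<in> ground M - F" for x
      using that F rank_uniform[OF M, of F] rank_uniform[OF M, of "insert x F"]
        finite_subset[OF F finite_ground] by (auto simp: min_def)
    then have "F \<in> flats M \<longleftrightarrow> (\<forall>x\<in>ground M - F. card F < d)" using F by (simp add: flats_def)
    then show ?thesis using F by auto
  qed
  then show ?thesis using flat_subset_ground[of _ M] by blast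
qed

lemma is_uniform_contract:
  assumes M: "is_uniform m d M" and F: "F \<subseteq> ground M" "card F \<le> d"
  shows "is_uniform m (d - card F) (contract M F)"
proof -
  have finF: "finite F" using F(1) by (rule finite_subset) simp
  have "I \<in> indeps (contract M F) \<longleftrightarrow> card I \<le> d - card F" if I: "I \<subseteq> ground M - F" for I
  proof -
    have "finite I" using I by (rule finite_subset) simp
    then have "card (I \<union> F) = card I + card F" using I finF by (intro card_Un_disjoint) auto
    moreover have "I \<union> F \<subseteq> ground M" using I F by auto
    ultimately show ?thesis
      using indep_contract_iff[OF I] rank_uniform[OF M] F by auto
  qed
  then have "indeps (contract M F) = {I. I \<subseteq> ground M - F \<and> card I \<le> d - card F}"
    using indep_subset_ground[of _ "contract M F"] by (auto simp: ground_contract)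
  moreover have "card (ground M - F) = m + (d - card F)"
    using M F finF by (simp add: card_Diff_subset is_uniform_def)
  ultimately show ?thesis by (simp add: is_uniform_def ground_contract)
qed

lemma contract_empty: "contract M {} = M"
proof (rule matroid_eqI)
  have [simp]: "rank_of M {} = 0" using rank_le_card[of "{}" M] by simp
  have "I \<in> indeps (contract M {}) \<longleftrightarrow> I \<in> indeps M" if "I \<subseteq> ground M" for I
    using indep_contract_iff[of I M "{}"] indep_iff_rank[of I M] that by simp
  then show "indeps (contract M {}) = indeps M"
    using indep_subset_ground[of _ M] indep_subset_ground[of _ "contract M {}"]
    unfolding ground_contract by blast
qed (simp add: ground_contract)

abbreviation real_poly :: "int poly \<Rightarrow> real poly" where
  "real_poly \<equiv> map_poly real_of_int"

lemma real_poly_sum: "real_poly (\<Sum>x\<in>A. f x) = (\<Sum>x\<in>A. real_poly (f x))"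
  by (rule poly_eqI) (simp add: coeff_map_poly coeff_sum)

lemma real_poly_monom_mult: "real_poly (monom 1 k * p) = monom 1 k * real_poly p"
  by (rule poly_eqI) (simp add: coeff_map_poly coeff_monom_mult')

text \<open>The flats below the top of a uniform matroid are the sets of fewer than \<open>d\<close> elements, so the
  Z-polynomial is a binomial transform of the Kazhdan--Lusztig polynomials.\<close>

lemma Z_poly_uniform:
  fixes p :: "nat \<Rightarrow> real poly"
  assumes M: "is_uniform m d M"
    and p: "\<And>F. F \<subseteq> ground M \<Longrightarrow> card F < d \<Longrightarrow> real_poly (KL_poly (contract M F)) = p (card F)"
  shows "real_poly (Z_poly M) =
    (\<Sum>k<d. smult (real ((m + d) choose k)) (monom 1 k * p k)) + monom 1 d"
proof -
  let ?S = "{F. F \<subseteq> ground M \<and> card F < d}"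
  let ?f = "\<lambda>F. monom 1 (rank_of M F) * real_poly (KL_poly (contract M F))"
  have card: "card (ground M) = m + d" using M by (simp add: is_uniform_def)
  have fin: "finite ?S" by (rule finite_subset[of _ "Pow (ground M)"]) auto
  have f: "?f F = monom 1 (card F) * p (card F)" if "F \<in> ?S" for F
    using that rank_uniform[OF M, of F] p[of F] by simp
  have rk: "rank M = d" using rank_uniform[OF M, of "ground M"] card by simp
  have "rank (contract M (ground M)) = 0"
    using rank_contract_flat[of "ground M" M] by simp
  then have top: "?f (ground M) = monom 1 d"
    using rk by (simp add: KL_poly_eq KL_rec_rank_0)
  have "real_poly (Z_poly M) = (\<Sum>F\<in>insert (ground M) ?S. ?f F)"
    unfolding Z_poly_def real_poly_sum real_poly_monom_mult flats_uniform[OF M] ..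
  also have "\<dots> = (\<Sum>F\<in>?S. ?f F) + monom 1 d"
    using fin card top by simp
  also have "(\<Sum>F\<in>?S. ?f F) = (\<Sum>F\<in>?S. monom 1 (card F) * p (card F))"
    using f by (rule sum.cong[OF refl])
  also have "\<dots> = (\<Sum>k<d. \<Sum>F\<in>{F\<in>?S. card F = k}. monom 1 (card F) * p (card F))"
    using fin by (intro sum.group[symmetric]) auto
  also have "\<dots> = (\<Sum>k<d. smult (real ((m + d) choose k)) (monom 1 k * p k))"
  proof (rule sum.cong[OF refl])
    fix k assume "k \<in> {..<d}"
    then have "{F\<in>?S. card F = k} = {F. F \<subseteq> ground M \<and> card F = k}" by auto
    then have "(\<Sum>F\<in>{F\<in>?S. card F = k}. monom 1 (card F) * p (card F)) =
        (\<Sum>F\<in>{F. F \<subseteq> ground M \<and> card F = k}. monom 1 k * p k)"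
      by (intro sum.cong) auto
    then show "(\<Sum>F\<in>{F\<in>?S. card F = k}. monom 1 (card F) * p (card F)) =
        smult (real ((m + d) choose k)) (monom 1 k * p k)"
      using n_subsets[of "ground M" k] card by (simp add: of_nat_poly)
  qed
  finally show ?thesis .
qed

lemma Z_poly_palindromic:
  assumes "i \<le> rank M"
  shows "coeff (Z_poly M) i = coeff (Z_poly M) (rank M - i)"
proof -
  have "degree (Z_rec M) \<le> rank M"
    unfolding Z_rec_def
  proof (rule degree_sum_le)
    fix F assume "F \<in> flats M"
    then show "degree (monom 1 (rank_of M F) * KL_rec (contract M F)) \<le> rank M"
      using degree_mult_le[of "monom (1::int) (rank_of M F)" "KL_rec (contract M F)"]
        degree_monom_le[of "1::int" "rank_of M F"] degree_KL_rec_contract[of F M] by simp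
  qed simp
  then show ?thesis
    using coeff_reverse_poly[of "Z_rec M" "rank M" i] assms
    by (simp add: Z_rec_palindromic Z_poly_eq)
qed

text \<open>A family of palindromic polynomials that satisfies the relation between Z-polynomials and
  Kazhdan--Lusztig polynomials of uniform matroids for some polynomials of low degree consists
  of the Z-polynomials: a difference at the smallest rank would be both palindromic and of degree
  below half the rank.\<close>

lemma Z_poly_uniform_unique:
  fixes \<zeta> p :: "nat \<Rightarrow> real poly"
  assumes pal: "\<And>d i. i \<le> d \<Longrightarrow> coeff (\<zeta> d) i = coeff (\<zeta> d) (d - i)"
    and low: "\<And>d i. d \<ge> 1 \<Longrightarrow> d \<le> 2 * i \<Longrightarrow> coeff (p d) i = 0"
    and \<zeta>: "\<And>d. d \<ge> 1 \<Longrightarrow>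
      \<zeta> d = (\<Sum>k<d. smult (real ((m + d) choose k)) (monom 1 k * p (d - k))) + monom 1 d"
    and M: "is_uniform m d (M :: 'a matroid)" and d: "d \<ge> 1"
  shows "real_poly (KL_poly M) = p d" "real_poly (Z_poly M) = \<zeta> d"
proof -
  have "real_poly (KL_poly M) = p d \<and> real_poly (Z_poly M) = \<zeta> d"
    using M d
  proof (induction d arbitrary: M rule: less_induct)
    case (less d M)
    let ?P = "real_poly (KL_poly M)" and ?Z = "real_poly (Z_poly M)"
    have rk: "rank M = d"
      using rank_uniform[OF less.prems(1), of "ground M"] less.prems(1) by (simp add: is_uniform_def)
    have "?Z = (\<Sum>k<d. smult (real ((m + d) choose k))
        (monom 1 k * (if k = 0 then ?P else p (d - k)))) + monom 1 d"
    proof (rule Z_poly_uniform[OF less.prems(1)])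
      fix F assume F: "F \<subseteq> ground M" "card F < d"
      show "real_poly (KL_poly (contract M F)) = (if card F = 0 then ?P else p (d - card F))"
      proof (cases "card F = 0")
        case True
        then have "F = {}" using F finite_subset[OF F(1)] by simp
        then show ?thesis by (simp add: contract_empty)
      next
        case False
        then show ?thesis
          using less.IH[of "d - card F" "contract M F"] is_uniform_contract[OF less.prems(1) F(1)] F
          by simp
      qed
    qed
    also have "\<dots> = ?P - p d + \<zeta> d"
    proof -
      have split: "{..<d} = insert 0 {1..<d}" using less.prems by auto
      show ?thesis
        unfolding \<zeta>[OF less.prems(2)] split by (subst (1 2) sum.insert) (auto simp: one_pCons monom_0)
    qed
    finally have Z: "?Z = ?P - p d + \<zeta> d" .
    have coeffP: "coeff ?P i = 0" if "d \<le> 2 * i" for i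
    proof -
      have "2 * degree (KL_rec M) < d" using degree_KL_rec[of M] rk less.prems by simp
      then show ?thesis using that by (simp add: coeff_map_poly KL_poly_eq coeff_eq_0)
    qed
    have "coeff ?P i = coeff (p d) i" for i
    proof (cases "2 * i < d")
      case True
      have "coeff ?Z i = coeff ?Z (d - i)"
        using Z_poly_palindromic[of i M] rk True by (simp add: coeff_map_poly)
      moreover have "d \<le> 2 * (d - i)" using True by simp
      then have "coeff ?P (d - i) = 0" "coeff (p d) (d - i) = 0"
        using coeffP[of "d - i"] low[of d "d - i"] less.prems by auto
      moreover have "coeff (\<zeta> d) i = coeff (\<zeta> d) (d - i)" using pal[of i d] True by simp
      ultimately show ?thesis unfolding Z by simp
    next
      case False
      then show ?thesis using coeffP[of i] low[of d i] less.prems by simp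
    qed
    then have "?P = p d" by (rule poly_eqI)
    then show ?case using Z by simp
  qed
  then show "real_poly (KL_poly M) = p d" "real_poly (Z_poly M) = \<zeta> d" by auto
qed

section \<open>The explicit Z-polynomials\<close>

text \<open>From here on, \<open>n + 1\<close> is the corank and \<open>D\<close> the rank. At \<open>i\<close> the polynomial below takes the
  value \<open>\<Sum>j\<le>n. (D + j choose j) * i (i + 1) \<cdots> (i + j - 1) * (i + j + 2) \<cdots> (i + n + 1)\<close>.
  It is regarded as a polynomial in \<open>i\<close> because its real roots decide on those of the
  Z-polynomials; the recursion exhibits its values at negative integers.\<close>

primrec numer :: "nat \<Rightarrow> nat \<Rightarrow> real poly" where
  "numer D 0 = 1"
| "numer D (Suc n) = [:real n + 2, 1:] * numer D n +
     smult (real ((D + n + 1) choose (n + 1))) (pochhammer [:0, 1:] (n + 1))"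

lemma poly_pochhammer: "poly (pochhammer p k) x = pochhammer (poly p x) k"
  by (induction k) (simp_all add: pochhammer_Suc)

lemma numer_over_fact:
  "poly (numer D n) (real i) / fact (i + n + 1) =
     (\<Sum>j\<le>n. real ((D + j) choose j) * pochhammer (real i) j / fact (i + j + 1))"
proof (induction n)
  case (Suc n)
  have "fact (i + Suc n + 1) = (real n + 2 + real i) * fact (i + n + 1)"
    by (simp add: algebra_simps)
  moreover have "real n + 2 + real i \<noteq> 0" by linarith
  ultimately have "(real n + 2 + real i) * poly (numer D n) (real i) / fact (i + Suc n + 1) =
      poly (numer D n) (real i) / fact (i + n + 1)"
    by (simp only: mult_divide_mult_cancel_left simp_thms if_False)
  moreover have "poly (numer D (Suc n)) (real i) = (real n + 2 + real i) * poly (numer D n) (real i) +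
      real ((D + Suc n) choose Suc n) * pochhammer (real i) (Suc n)"
    by (simp add: poly_pochhammer distrib_right del: binomial_Suc_Suc)
  ultimately show ?case
    using Suc by (simp add: add_divide_distrib del: binomial_Suc_Suc fact_Suc)
qed simp

text \<open>The coefficients of the Z-polynomial in the basis \<open>x\<^sup>i (1 + x)\<^bsup>D - 2 i\<^esup>\<close> of the palindromic
  polynomials.\<close>

definition gamma_coeff :: "nat \<Rightarrow> nat \<Rightarrow> nat \<Rightarrow> real" where
  "gamma_coeff n D i = fact D * poly (numer D n) (real i) / (fact (D - 2 * i) * fact i * fact (i + n + 1))"

definition zeta :: "nat \<Rightarrow> nat \<Rightarrow> real poly" where
  "zeta n D = (\<Sum>i\<le>D div 2. smult (gamma_coeff n D i) (monom 1 i * [:1, 1:] ^ (D - 2 * i)))"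

lemma coeff_zeta:
  "coeff (zeta n D) a =
     (\<Sum>i\<le>D div 2. if i \<le> a then gamma_coeff n D i * real ((D - 2 * i) choose (a - i)) else 0)"
  unfolding zeta_def coeff_sum
proof (rule sum.cong[OF refl])
  fix i
  have "coeff ([:1, 1:] ^ N) k = real (N choose k)" for N k :: nat
    using coeff_linear_poly_power[of k N "1::real" 1]
    by (cases "k \<le> N") (auto simp: binomial_eq_0 coeff_eq_0 degree_power_eq)
  then show "coeff (smult (gamma_coeff n D i) (monom 1 i * [:1, 1:] ^ (D - 2 * i))) a =
      (if i \<le> a then gamma_coeff n D i * real ((D - 2 * i) choose (a - i)) else 0)"
    by (simp add: coeff_monom_mult)
qed

lemma coeff_zeta_palindromic:
  assumes "a \<le> D"
  shows "coeff (zeta n D) a = coeff (zeta n D) (D - a)"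
  unfolding coeff_zeta
proof (rule sum.cong[OF refl])
  fix i assume i: "i \<in> {..D div 2}"
  consider "i \<le> a" "i \<le> D - a" | "i > a" | "i > D - a" by linarith
  then show "(if i \<le> a then gamma_coeff n D i * real ((D - 2 * i) choose (a - i)) else 0) =
    (if i \<le> D - a then gamma_coeff n D i * real ((D - 2 * i) choose (D - a - i)) else 0)"
  proof cases
    case 1
    then have "D - 2 * i - (a - i) = D - a - i" "a - i \<le> D - 2 * i" using assms by linarith+
    then show ?thesis using 1 binomial_symmetric[of "a - i" "D - 2 * i"] by simp
  next
    case 2
    then have "D - 2 * i < D - a - i" if "i \<le> D - a" using i that assms by auto
    then show ?thesis using 2 by (simp add: binomial_eq_0)
  next
    case 3
    then have "D - 2 * i < a - i" if "i \<le> a" using i that assms by auto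
    then show ?thesis using 3 by (simp add: binomial_eq_0)
  qed
qed

lemma gamma_coeff_eq:
  "gamma_coeff n D i =
     (\<Sum>j\<le>n. fact (D + j) * pochhammer (real i) j / (fact (D - 2 * i) * fact i * fact j * fact (i + j + 1)))"
proof -
  have "gamma_coeff n D i = fact D / (fact (D - 2 * i) * fact i) *
      (poly (numer D n) (real i) / fact (i + n + 1))"
    by (simp add: gamma_coeff_def del: fact_Suc)
  also have "\<dots> = (\<Sum>j\<le>n. fact D / (fact (D - 2 * i) * fact i) *
      (real ((D + j) choose j) * pochhammer (real i) j / fact (i + j + 1)))"
    unfolding numer_over_fact sum_distrib_left ..
  also have "\<dots> = (\<Sum>j\<le>n. fact (D + j) * pochhammer (real i) j /
      (fact (D - 2 * i) * fact i * fact j * fact (i + j + 1)))"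
  proof (rule sum.cong[OF refl])
    fix j
    have "real ((D + j) choose j) = fact (D + j) / (fact j * fact D)"
      by (simp add: binomial_fact)
    then show "fact D / (fact (D - 2 * i) * fact i) *
      (real ((D + j) choose j) * pochhammer (real i) j / fact (i + j + 1)) =
      fact (D + j) * pochhammer (real i) j / (fact (D - 2 * i) * fact i * fact j * fact (i + j + 1))"
      by (simp add: field_simps del: fact_Suc)
  qed
  finally show ?thesis .
qed

lemma coeff_zeta_fact:
  "coeff (zeta n (a + b)) a =
     (\<Sum>i\<le>b. if i \<le> a then
        (\<Sum>j\<le>n. pochhammer (real i) j / (fact (b - i) * fact i * fact j * fact (i + j + 1)) *
           (fact (a + b + j) / fact (a - i))) else 0)"
proof -
  let ?g = "\<lambda>i. if i \<le> a then gamma_coeff n (a + b) i * real ((a + b - 2 * i) choose (a - i)) else 0"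
  \<comment> \<open>Outside the common range of summation, \<open>i > a\<close>, or else \<open>i > b\<close> and thus
    \<open>a - i > a + b - 2 i\<close>.\<close>
  have zero: "?g i = 0" if "i > b \<or> i > (a + b) div 2" "i \<le> b \<or> i \<le> (a + b) div 2" for i
    using that by (auto simp: binomial_eq_0)
  have "coeff (zeta n (a + b)) a = (\<Sum>i\<in>{..(a + b) div 2} \<union> {..b}. ?g i)"
    unfolding coeff_zeta using zero by (intro sum.mono_neutral_left) auto
  also have "\<dots> = (\<Sum>i\<le>b. ?g i)"
    using zero by (intro sum.mono_neutral_right) auto
  also have "\<dots> = (\<Sum>i\<le>b. if i \<le> a then
        (\<Sum>j\<le>n. pochhammer (real i) j / (fact (b - i) * fact i * fact j * fact (i + j + 1)) *
           (fact (a + b + j) / fact (a - i))) else 0)"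
  proof (rule sum.cong[OF refl])
    fix i assume i: "i \<in> {..b}"
    have "real ((a + b - 2 * i) choose (a - i)) = fact (a + b - 2 * i) / (fact (a - i) * fact (b - i))"
      if "i \<le> a"
    proof -
      have "a + b - 2 * i - (a - i) = b - i" using that i by auto
      then show ?thesis using that i by (subst binomial_fact) auto
    qed
    moreover have "t * z / (fact N * p * q * r) * (fact N / (v * w)) = z / (w * p * q * r) * (t / v)"
      for p q r v w z t :: real and N
      by (simp add: mult_ac)
    ultimately show "?g i = (if i \<le> a then
        (\<Sum>j\<le>n. pochhammer (real i) j / (fact (b - i) * fact i * fact j * fact (i + j + 1)) *
           (fact (a + b + j) / fact (a - i))) else 0)"
      unfolding gamma_coeff_eq sum_distrib_right by (simp only: refl split: if_split) simp
  qed
  finally show ?thesis .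
qed

section \<open>Vanishing of the upper coefficients\<close>

lemma minus_one_power_diff:
  assumes "k \<le> t"
  shows "(-1::real) ^ (t - k) = (-1) ^ t * (-1) ^ k"
proof -
  have "(-1::real) ^ t = (-1) ^ (t - k) * (-1) ^ k" using assms by (simp flip: power_add)
  then show ?thesis by (simp add: mult.assoc)
qed

text \<open>Up to signs and factorials, the quotient of factorials is a binomial coefficient with upper
  index \<open>- c - 1\<close>, so this is an instance of Vandermonde's identity.\<close>

lemma alternating_binomial_fact_sum:
  assumes "c < N"
  shows "(\<Sum>k\<le>t. (-1) ^ k * real (N choose k) * (fact (t - k + c) / fact (t - k))) =
    (-1) ^ t * fact c * real ((N - c - 1) choose t)"
proof -
  have neg: "(- real c - 1) gchoose r = (-1) ^ r * fact (r + c) / (fact r * fact c)" for r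
  proof -
    have "(- real c - 1) gchoose r = (-1) ^ r * (real (r + c) gchoose r)"
      by (subst gbinomial_negated_upper) (simp add: algebra_simps)
    also have "real (r + c) gchoose r = fact (r + c) / (fact r * fact c)"
      unfolding binomial_gbinomial[symmetric] by (subst binomial_fact) simp_all
    finally show ?thesis by simp
  qed
  have "real ((N - c - 1) choose t) = (real N + (- real c - 1)) gchoose t"
    using assms by (simp add: binomial_gbinomial of_nat_diff algebra_simps)
  also have "\<dots> = (\<Sum>k\<le>t. (real N gchoose k) * ((- real c - 1) gchoose (t - k)))"
    by (simp only: gbinomial_Vandermonde[symmetric] atLeast0AtMost)
  finally have "(-1) ^ t * fact c * real ((N - c - 1) choose t) =
    (\<Sum>k\<le>t. (-1) ^ t * fact c * ((real N gchoose k) * ((- real c - 1) gchoose (t - k))))"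
    by (simp add: sum_distrib_left)
  also have "\<dots> = (\<Sum>k\<le>t. (-1) ^ k * real (N choose k) * (fact (t - k + c) / fact (t - k)))"
  proof (rule sum.cong[OF refl])
    fix k assume "k \<in> {..t}"
    then have sgn: "(-1::real) ^ k = (-1) ^ t * (-1) ^ (t - k)"
      using minus_one_power_diff[of "t - k" t] by simp
    show "(-1) ^ t * fact c * ((real N gchoose k) * ((- real c - 1) gchoose (t - k))) =
        (-1) ^ k * real (N choose k) * (fact (t - k + c) / fact (t - k))"
      unfolding neg sgn by (simp add: binomial_gbinomial)
  qed
  finally show ?thesis by simp
qed

lemma sum_binomial_difference:
  fixes f :: "nat \<Rightarrow> real"
  shows "(\<Sum>i\<le>Suc b. (-1) ^ i * real (Suc b choose i) * f i) =
    (\<Sum>i\<le>b. (-1) ^ i * real (b choose i) * (f i - f (Suc i)))"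
proof -
  have "(\<Sum>i\<le>Suc b. (-1) ^ i * real (Suc b choose i) * f i) =
      f 0 + (\<Sum>i\<le>b. (-1) ^ Suc i * real (Suc b choose Suc i) * f (Suc i))"
    by (subst sum.atMost_Suc_shift) simp
  also have "\<dots> = f 0 + (\<Sum>i\<le>b. (-1) ^ Suc i * real (b choose Suc i) * f (Suc i)) -
      (\<Sum>i\<le>b. (-1) ^ i * real (b choose i) * f (Suc i))"
    by (simp add: algebra_simps sum.distrib sum_subtractf sum_negf)
  also have "f 0 + (\<Sum>i\<le>b. (-1) ^ Suc i * real (b choose Suc i) * f (Suc i)) =
      (\<Sum>i\<le>Suc b. (-1) ^ i * real (b choose i) * f i)"
    by (subst sum.atMost_Suc_shift) simp
  also have "\<dots> = (\<Sum>i\<le>b. (-1) ^ i * real (b choose i) * f i)" by simp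
  finally show ?thesis by (simp add: algebra_simps sum_subtractf)
qed

text \<open>A \<open>b\<close>-th difference of a polynomial of degree \<open>l < b\<close>.\<close>

lemma alternating_pochhammer_sum:
  fixes x :: real
  assumes "l < b"
  shows "(\<Sum>i\<le>b. (-1) ^ i * real (b choose i) * pochhammer (x + real i) l) = 0"
  using assms
proof (induction b arbitrary: l x)
  case (Suc b)
  show ?case
  proof (cases l)
    case 0
    then show ?thesis unfolding sum_binomial_difference by simp
  next
    case (Suc l')
    have diff: "pochhammer (x + real i) l - pochhammer (x + real (Suc i)) l =
        - real l * pochhammer (x + 1 + real i) l'" for i
    proof -
      have "pochhammer (x + real i) l = (x + real i) * pochhammer (x + 1 + real i) l'"
        by (simp add: Suc pochhammer_rec add_ac)
      moreover have "pochhammer (x + real (Suc i)) l =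
          (x + 1 + real i + real l') * pochhammer (x + 1 + real i) l'"
        by (simp add: Suc pochhammer_rec' add_ac)
      ultimately show ?thesis by (simp add: Suc algebra_simps)
    qed
    have "(\<Sum>i\<le>Suc b. (-1) ^ i * real (Suc b choose i) * pochhammer (x + real i) l) =
        - real l * (\<Sum>i\<le>b. (-1) ^ i * real (b choose i) * pochhammer (x + 1 + real i) l')"
      unfolding sum_binomial_difference diff sum_distrib_left by (simp add: mult_ac)
    then show ?thesis using Suc.IH[of l' "x + 1"] Suc.prems Suc by simp
  qed
qed simp

lemma fact_quotient_pochhammer_basis:
  assumes "b \<ge> 1"
  obtains c :: "nat \<Rightarrow> real"
  where "\<And>y. fact (b + y) / fact (y + 1) = (\<Sum>l<b. c l * pochhammer (real y) l)"
proof -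
  have "\<exists>c. \<forall>y. fact (b + y) / fact (y + 1) = (\<Sum>l<b. c l * pochhammer (real y) l)"
    using assms
  proof (induction b rule: dec_induct)
    case base
    show ?case by (rule exI[of _ "\<lambda>_. 1"]) (simp add: add.commute)
  next
    case (step b)
    then obtain c where c: "\<And>y. fact (b + y) / fact (y + 1) = (\<Sum>l<b. c l * pochhammer (real y) l)"
      by blast
    \<comment> \<open>The factor passing from \<open>b\<close> to \<open>b + 1\<close> is \<open>y + b + 1 = (y + l) + (b + 1 - l)\<close>.\<close>
    define c' where "c' l = (if l = 0 then 0 else c (l - 1)) +
        (if l < b then c l * (real b + 1 - real l) else 0)" for l
    have "fact (Suc b + y) / fact (y + 1) = (\<Sum>l<Suc b. c' l * pochhammer (real y) l)" for y
    proof -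
      have "fact (Suc b + y) / fact (y + 1) = (real y + real b + 1) * (fact (b + y) / fact (y + 1))"
        by (simp add: algebra_simps)
      also have "\<dots> = (\<Sum>l<b. c l * (pochhammer (real y) l * (real y + real b + 1)))"
        unfolding c sum_distrib_left by (simp add: mult_ac)
      also have "\<dots> = (\<Sum>l<b. c l * pochhammer (real y) (Suc l)) +
          (\<Sum>l<b. c l * (real b + 1 - real l) * pochhammer (real y) l)"
        unfolding sum.distrib[symmetric]
        by (rule sum.cong) (simp_all add: pochhammer_rec' algebra_simps)
      also have "(\<Sum>l<b. c l * pochhammer (real y) (Suc l)) =
          (\<Sum>l<Suc b. (if l = 0 then 0 else c (l - 1)) * pochhammer (real y) l)"
        by (subst sum.lessThan_Suc_shift) simp
      also have "(\<Sum>l<b. c l * (real b + 1 - real l) * pochhammer (real y) l) =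
          (\<Sum>l<Suc b. (if l < b then c l * (real b + 1 - real l) else 0) * pochhammer (real y) l)"
        by simp
      finally show ?thesis
        unfolding c'_def by (simp only: distrib_right sum.distrib)
    qed
    then show ?case by blast
  qed
  then show ?thesis using that by blast
qed

text \<open>Once the sum over \<open>k\<close> is evaluated, a double sum of products of factorials remains. The quotient
  \<open>(b + i + j)! / (i + j + 1)!\<close> is a polynomial of degree \<open>b - 1\<close> in \<open>i + j\<close>; expanded in rising
  factorials it makes the sum over \<open>j\<close> a Vandermonde convolution whose value depends on \<open>i\<close>
  only through a rising factorial of length less than \<open>b\<close>, which the alternating sum over \<open>i\<close>
  annihilates.\<close>

lemma zeta_upper_coeff_sum:
  assumes b: "1 \<le> b" "b \<le> s"
  shows "(\<Sum>k\<le>s. (-1) ^ k * real ((n + 1 + (s + b)) choose k) * coeff (zeta n (s + b - k)) (s - k)) = 0"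
proof -
  define N where "N = n + 1 + (s + b)"
  define C where "C i j = pochhammer (real i) j / (fact (b - i) * fact i * fact j * fact (i + j + 1))"
    for i j
  obtain c :: "nat \<Rightarrow> real"
    where c: "\<And>y. fact (b + y) / fact (y + 1) = (\<Sum>l<b. c l * pochhammer (real y) l)"
    by (rule fact_quotient_pochhammer_basis[OF b(1)]) blast
  have coeff: "coeff (zeta n (s + b - k)) (s - k) = (\<Sum>i\<le>b. if i + k \<le> s then
      (\<Sum>j\<le>n. C i j * (fact (s - i - k + (b + i + j)) / fact (s - i - k))) else 0)"
    if "k \<le> s" for k
  proof -
    have "coeff (zeta n (s + b - k)) (s - k) = coeff (zeta n ((s - k) + b)) (s - k)"
      using that by simp
    also have "\<dots> = (\<Sum>i\<le>b. if i \<le> s - k then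
      (\<Sum>j\<le>n. C i j * (fact (s - k + b + j) / fact (s - k - i))) else 0)"
      unfolding coeff_zeta_fact C_def ..
    also have "\<dots> = (\<Sum>i\<le>b. if i + k \<le> s then
      (\<Sum>j\<le>n. C i j * (fact (s - i - k + (b + i + j)) / fact (s - i - k))) else 0)"
    proof (rule sum.cong[OF refl])
      fix i
      have "s - k + b + j = s - i - k + (b + i + j)" "s - k - i = s - i - k" if "i + k \<le> s" for j
        using that by auto
      moreover have "i \<le> s - k \<longleftrightarrow> i + k \<le> s" using \<open>k \<le> s\<close> by auto
      ultimately show "(if i \<le> s - k then
          (\<Sum>j\<le>n. C i j * (fact (s - k + b + j) / fact (s - k - i))) else 0) =
        (if i + k \<le> s then
          (\<Sum>j\<le>n. C i j * (fact (s - i - k + (b + i + j)) / fact (s - i - k))) else 0)"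
        by simp
    qed
    finally show ?thesis .
  qed
  have inner: "(\<Sum>k\<le>s. if i + k \<le> s then (-1) ^ k * real (N choose k) *
        (fact (s - i - k + (b + i + j)) / fact (s - i - k)) else 0) =
      (-1) ^ (s - i) * fact (b + i + j) * (pochhammer (real (s - i) + 1) (n - j) / fact (n - j))"
    if i: "i \<le> b" and j: "j \<le> n" for i j
  proof -
    have "(\<Sum>k\<le>s. if i + k \<le> s then (-1) ^ k * real (N choose k) *
        (fact (s - i - k + (b + i + j)) / fact (s - i - k)) else 0) =
      (\<Sum>k\<le>s - i. (-1) ^ k * real (N choose k) * (fact (s - i - k + (b + i + j)) / fact (s - i - k)))"
      using i b by (intro sum.mono_neutral_cong_right) auto
    also have "\<dots> = (-1) ^ (s - i) * fact (b + i + j) * real ((N - (b + i + j) - 1) choose (s - i))"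
      using i j b by (intro alternating_binomial_fact_sum) (auto simp: N_def)
    also have "N - (b + i + j) - 1 = s - i + (n - j)" using i j b by (simp add: N_def)
    also have "real ((s - i + (n - j)) choose (s - i)) = fact (s - i + (n - j)) / (fact (s - i) * fact (n - j))"
      by (simp add: binomial_fact)
    also have "fact (s - i + (n - j)) = fact (s - i) * pochhammer (real (s - i) + 1) (n - j)"
      using pochhammer_product'[of "1::real" "s - i" "n - j"] by (simp add: pochhammer_fact add.commute)
    finally show ?thesis by simp
  qed
  \<comment> \<open>The only dependence on \<open>i\<close> left after summation over \<open>j\<close> is in \<open>pochhammer i l\<close> and in the
    two factorials.\<close>
  have vand: "(\<Sum>j\<le>n. C i j * fact (b + i + j) * (pochhammer (real (s - i) + 1) (n - j) / fact (n - j))) =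
      1 / (fact (b - i) * fact i) * (\<Sum>l<b. c l * pochhammer (real i) l *
        (pochhammer (real s + real l + 1) n / fact n))"
    if i: "i \<le> b" for i
  proof -
    have conv: "(\<Sum>j\<le>n. pochhammer (real i + real l) j / fact j *
        (pochhammer (real (s - i) + 1) (n - j) / fact (n - j))) =
        pochhammer (real s + real l + 1) n / fact n" for l
    proof -
      have eq: "real s + real l + 1 = (real i + real l) + (real (s - i) + 1)" using i b by simp
      show ?thesis
        unfolding eq pochhammer_binomial_sum[of "real i + real l"] sum_divide_distrib
        by (rule sum.cong) (simp_all add: binomial_fact field_simps)
    qed
    have term_eq: "C i j * fact (b + i + j) = 1 / (fact (b - i) * fact i) *
        (\<Sum>l<b. c l * pochhammer (real i) l * (pochhammer (real i + real l) j / fact j))" for j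
    proof -
      have "C i j * fact (b + i + j) = 1 / (fact (b - i) * fact i) *
          (pochhammer (real i) j / fact j * (fact (b + (i + j)) / fact ((i + j) + 1)))"
        unfolding C_def by (simp add: add.assoc del: fact_Suc)
      also have "pochhammer (real i) j / fact j * (fact (b + (i + j)) / fact ((i + j) + 1)) =
          (\<Sum>l<b. c l * (pochhammer (real i) j * pochhammer (real i + real j) l) / fact j)"
        unfolding c by (simp add: sum_distrib_left mult_ac)
      also have "\<dots> = (\<Sum>l<b. c l * pochhammer (real i) l * (pochhammer (real i + real l) j / fact j))"
      proof (rule sum.cong[OF refl])
        fix l
        have "pochhammer (real i) j * pochhammer (real i + real j) l =
            pochhammer (real i) l * pochhammer (real i + real l) j"
          using pochhammer_product'[of "real i" j l] pochhammer_product'[of "real i" l j]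
          by (simp add: add.commute)
        then show "c l * (pochhammer (real i) j * pochhammer (real i + real j) l) / fact j =
            c l * pochhammer (real i) l * (pochhammer (real i + real l) j / fact j)" by simp
      qed
      finally show ?thesis .
    qed
    have "(\<Sum>j\<le>n. C i j * fact (b + i + j) * (pochhammer (real (s - i) + 1) (n - j) / fact (n - j))) =
        1 / (fact (b - i) * fact i) * (\<Sum>l<b. c l * pochhammer (real i) l *
          (\<Sum>j\<le>n. pochhammer (real i + real l) j / fact j *
            (pochhammer (real (s - i) + 1) (n - j) / fact (n - j))))"
      unfolding term_eq sum_distrib_left sum_distrib_right
      by (subst sum.swap) (simp add: mult_ac)
    then show ?thesis unfolding conv .
  qed
  have "(\<Sum>k\<le>s. (-1) ^ k * real (N choose k) * coeff (zeta n (s + b - k)) (s - k)) =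
      (\<Sum>k\<le>s. \<Sum>i\<le>b. \<Sum>j\<le>n. C i j * (if i + k \<le> s then (-1) ^ k * real (N choose k) *
        (fact (s - i - k + (b + i + j)) / fact (s - i - k)) else 0))"
    by (rule sum.cong[OF refl])
      (auto simp: coeff sum_distrib_left intro!: sum.cong)
  also have "\<dots> = (\<Sum>i\<le>b. \<Sum>j\<le>n. C i j * (\<Sum>k\<le>s. if i + k \<le> s then (-1) ^ k * real (N choose k) *
        (fact (s - i - k + (b + i + j)) / fact (s - i - k)) else 0))"
    unfolding sum_distrib_left by (subst sum.swap, rule sum.cong[OF refl], rule sum.swap)
  also have "\<dots> = (\<Sum>i\<le>b. (-1) ^ (s - i) *
      (\<Sum>j\<le>n. C i j * fact (b + i + j) * (pochhammer (real (s - i) + 1) (n - j) / fact (n - j))))"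
  proof (rule sum.cong[OF refl])
    fix i assume i: "i \<in> {..b}"
    show "(\<Sum>j\<le>n. C i j * (\<Sum>k\<le>s. if i + k \<le> s then (-1) ^ k * real (N choose k) *
        (fact (s - i - k + (b + i + j)) / fact (s - i - k)) else 0)) =
      (-1) ^ (s - i) * (\<Sum>j\<le>n. C i j * fact (b + i + j) *
        (pochhammer (real (s - i) + 1) (n - j) / fact (n - j)))"
      unfolding sum_distrib_left[of "(-1) ^ (s - i)"]
    proof (rule sum.cong[OF refl])
      fix j assume "j \<in> {..n}"
      then show "C i j * (\<Sum>k\<le>s. if i + k \<le> s then (-1) ^ k * real (N choose k) *
          (fact (s - i - k + (b + i + j)) / fact (s - i - k)) else 0) =
        (-1) ^ (s - i) * (C i j * fact (b + i + j) *
          (pochhammer (real (s - i) + 1) (n - j) / fact (n - j)))"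
        using inner[of i j] i by simp
    qed
  qed
  also have "\<dots> = (\<Sum>i\<le>b. (-1) ^ (s - i) * (1 / (fact (b - i) * fact i) * (\<Sum>l<b. c l * pochhammer (real i) l *
        (pochhammer (real s + real l + 1) n / fact n))))"
    by (intro sum.cong refl) (simp only: vand atMost_iff)
  also have "\<dots> = (\<Sum>l<b. c l * (pochhammer (real s + real l + 1) n / fact n) * ((-1) ^ s / fact b) *
      (\<Sum>i\<le>b. (-1) ^ i * real (b choose i) * pochhammer (real i) l))"
    unfolding sum_distrib_left
  proof (subst sum.swap, intro sum.cong refl)
    fix i l assume "i \<in> {..b}"
    then have "i \<le> s" using b by auto
    then have sgn: "(-1::real) ^ s * (-1) ^ i = (-1) ^ (s - i)"
      by (rule minus_one_power_diff[symmetric])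
    have "(-1) ^ s / fact b * ((-1) ^ i * real (b choose i)) = (-1) ^ (s - i) / (fact (b - i) * fact i)"
      unfolding sgn[symmetric] using \<open>i \<in> {..b}\<close> by (simp add: binomial_fact mult.commute)
    moreover have "u * (1 / v * (x * y * w)) = x * w * p * (q * y)" if "p * q = u / v" for u v w x y p q :: real
      using arg_cong[OF that, of "\<lambda>t. x * y * w * t"] by (simp add: mult_ac)
    ultimately show "(-1) ^ (s - i) * (1 / (fact (b - i) * fact i) * (c l * pochhammer (real i) l *
        (pochhammer (real s + real l + 1) n / fact n))) =
      c l * (pochhammer (real s + real l + 1) n / fact n) * ((-1) ^ s / fact b) *
        ((-1) ^ i * real (b choose i) * pochhammer (real i) l)"
      by blast
  qed
  also have "\<dots> = 0" using alternating_pochhammer_sum[where x = 0] by simp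
  finally show ?thesis unfolding N_def .
qed

text \<open>The inverse of the binomial transform by which the Kazhdan--Lusztig polynomials of
  \<open>U\<^sub>m\<^sub>,\<^sub>d\<close> give the Z-polynomials.\<close>

lemma binomial_inversion:
  fixes f p :: "nat \<Rightarrow> real poly"
  assumes p: "\<And>d. p d = (\<Sum>k<d. smult ((-1) ^ k * real ((m + d) choose k)) (monom 1 k * f (d - k)))"
  shows "(\<Sum>k<d. smult (real ((m + d) choose k)) (monom 1 k * p (d - k))) = (if d = 0 then 0 else f d)"
proof -
  let ?N = "m + d"
  let ?g = "\<lambda>k l. smult (real (?N choose k) * ((-1) ^ l * real ((?N - k) choose l)))
    (monom 1 (k + l) * f (d - (k + l)))"
  have "(\<Sum>k<d. smult (real (?N choose k)) (monom 1 k * p (d - k))) = (\<Sum>k<d. \<Sum>l<d - k. ?g k l)"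
  proof (rule sum.cong[OF refl])
    fix k assume "k \<in> {..<d}"
    then have "m + (d - k) = ?N - k" by auto
    then show "smult (real (?N choose k)) (monom 1 k * p (d - k)) = (\<Sum>l<d - k. ?g k l)"
      unfolding p sum_distrib_left
      by (simp add: poly_eq_iff coeff_sum sum_distrib_left mult_monom mult.assoc[symmetric])
  qed
  also have "\<dots> = (\<Sum>(k, l)\<in>{(k, l). k + l < d}. ?g k l)"
  proof -
    have "(SIGMA k:{..<d}. {..<d - k}) = {(k, l). k + l < d}" by auto
    then show ?thesis by (subst sum.Sigma) auto
  qed
  also have "\<dots> = (\<Sum>r<d. \<Sum>k\<le>r. ?g k (r - k))" by (rule sum.triangle_reindex)
  also have "\<dots> = (\<Sum>r<d. if r = 0 then f d else 0)"
  proof (rule sum.cong[OF refl])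
    fix r assume r: "r \<in> {..<d}"
    have "(\<Sum>k\<le>r. ?g k (r - k)) = smult (\<Sum>k\<le>r. real (?N choose k) * ((-1) ^ (r - k) *
        real ((?N - k) choose (r - k)))) (monom 1 r * f (d - r))"
      unfolding smult_sum by (rule sum.cong) simp_all
    also have "(\<Sum>k\<le>r. real (?N choose k) * ((-1) ^ (r - k) * real ((?N - k) choose (r - k)))) =
        real (?N choose r) * (-1) ^ r * (\<Sum>k\<le>r. (-1) ^ k * real (r choose k))"
      unfolding sum_distrib_left
    proof (rule sum.cong[OF refl])
      fix k assume "k \<in> {..r}"
      then have k: "k \<le> r" by simp
      have "(?N choose r) * (r choose k) = (?N choose k) * ((?N - k) choose (r - k))"
        using k r by (intro choose_mult) auto
      then have "real (?N choose r) * real (r choose k) = real (?N choose k) * real ((?N - k) choose (r - k))"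
        by (metis of_nat_mult)
      moreover have "(-1::real) ^ r * (-1) ^ k = (-1) ^ (r - k)"
        using minus_one_power_diff[OF k] by simp
      ultimately show "real (?N choose k) * ((-1) ^ (r - k) * real ((?N - k) choose (r - k))) =
          real (?N choose r) * (-1) ^ r * ((-1) ^ k * real (r choose k))"
        by (simp add: mult_ac) (simp add: mult.assoc[symmetric])
    qed
    also have "(\<Sum>k\<le>r. (-1) ^ k * real (r choose k)) = (if r = 0 then 1 else 0)"
      using choose_alternating_sum[of r, where 'a = real] by auto
    finally show "(\<Sum>k\<le>r. ?g k (r - k)) = (if r = 0 then f d else 0)" by (auto simp: monom_0 one_pCons)
  qed
  also have "\<dots> = (if d = 0 then 0 else f d)" by simp
  finally show ?thesis .
qed

definition kl :: "nat \<Rightarrow> nat \<Rightarrow> real poly" where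
  "kl n d = (\<Sum>k<d. smult ((-1) ^ k * real ((n + 1 + d) choose k))
     (monom 1 k * (zeta n (d - k) - monom 1 (d - k))))"

lemma poly_numer_0: "poly (numer D n) 0 = fact (n + 1)"
  by (induction n) (simp_all add: poly_pochhammer algebra_simps pochhammer_0_left
    del: pochhammer_Suc)

lemma gamma_coeff_0 [simp]: "gamma_coeff n D 0 = 1"
  using poly_numer_0[of D n] by (simp add: gamma_coeff_def del: fact_Suc)

lemma coeff_zeta_top: "coeff (zeta n D) D = 1"
proof -
  have "coeff (zeta n D) D = coeff (zeta n D) 0" using coeff_zeta_palindromic[of D D n] by simp
  also have "\<dots> = (\<Sum>i\<le>D div 2. if i = 0 then 1 else 0)"
    unfolding coeff_zeta by (rule sum.cong) auto
  finally show ?thesis by simp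
qed

lemma coeff_zeta_above: "D < a \<Longrightarrow> coeff (zeta n D) a = 0"
  unfolding coeff_zeta by (rule sum.neutral) (auto simp: binomial_eq_0)

lemma coeff_kl_upper:
  assumes "d \<ge> 1" "d \<le> 2 * s"
  shows "coeff (kl n d) s = 0"
proof -
  have c: "coeff (kl n d) s = (\<Sum>k<d. (-1) ^ k * real ((n + 1 + d) choose k) *
      (if k \<le> s then coeff (zeta n (d - k)) (s - k) - (if s = d then 1 else 0) else 0))"
    unfolding kl_def coeff_sum
    by (rule sum.cong) (auto simp: coeff_monom_mult coeff_monom)
  consider "s < d" | "s = d" | "s > d" by linarith
  then show ?thesis
  proof cases
    case 1
    then have "coeff (kl n d) s =
        (\<Sum>k\<le>s. (-1) ^ k * real ((n + 1 + d) choose k) * coeff (zeta n (d - k)) (s - k))"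
      unfolding c by (intro sum.mono_neutral_cong_right) auto
    then show ?thesis using zeta_upper_coeff_sum[of "d - s" s n] 1 assms by simp
  next
    case 2
    then show ?thesis unfolding c by (intro sum.neutral) (auto simp: coeff_zeta_top)
  next
    case 3
    then show ?thesis unfolding c by (intro sum.neutral) (auto simp: coeff_zeta_above)
  qed
qed

lemma zeta_eq_kl_sum:
  assumes "d \<ge> 1"
  shows "zeta n d = (\<Sum>k<d. smult (real ((n + 1 + d) choose k)) (monom 1 k * kl n (d - k))) + monom 1 d"
  using binomial_inversion[of "kl n" "n + 1" "\<lambda>d. zeta n d - monom 1 d" d] assms
  by (simp add: kl_def)

section \<open>Sign changes at simple roots\<close>

text \<open>A polynomial with as many distinct roots as its degree allows has only simple roots; this is how
  simplicity of all roots is expressed below.\<close>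

lemma eq_prod_roots:
  fixes f :: "real poly"
  assumes "Z \<subseteq> {x. poly f x = 0}" "finite Z" "card Z = degree f"
  shows "f = smult (lead_coeff f) (\<Prod>z\<in>Z. [:-z, 1:])"
proof -
  let ?g = "\<Prod>z\<in>Z. [:-z, 1:]"
  have deg: "degree ?g = card Z" by (subst degree_prod_sum_eq) auto
  have lead: "lead_coeff ?g = 1" by (simp add: lead_coeff_prod)
  show ?thesis
  proof (rule poly_eqI_degree_lead_coeff[of _ "degree f" _ Z])
    show "poly f z = poly (smult (lead_coeff f) ?g) z" if "z \<in> Z" for z
      using that assms by (auto simp: poly_prod)
  qed (use deg lead assms in auto)
qed

lemma poly_pderiv_linear_mult: "poly (pderiv ([:c, 1:] * g)) (- c) = poly g (- c :: real)"
  by (subst pderiv_mult) (simp add: pderiv_pCons)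

lemma pderiv_nz_at_root:
  fixes f :: "real poly"
  assumes "f \<noteq> 0" "card {x. poly f x = 0} = degree f" "poly f z = 0"
  shows "poly (pderiv f) z \<noteq> 0"
proof -
  let ?Z = "{x. poly f x = 0}"
  have fin: "finite ?Z" using assms(1) by (rule poly_roots_finite)
  let ?g = "\<Prod>w\<in>?Z - {z}. [:-w, 1:]"
  have "f = smult (lead_coeff f) ([:-z, 1:] * ?g)"
    using eq_prod_roots[of ?Z f] fin assms by (simp add: prod.remove[of ?Z z])
  then have "pderiv f = smult (lead_coeff f) (pderiv ([:-z, 1:] * ?g))"
    by (metis pderiv_smult)
  then have "poly (pderiv f) z = lead_coeff f * poly ?g z"
    using poly_pderiv_linear_mult[of "- z" ?g] by (simp only: poly_smult minus_minus)
  moreover have "poly ?g z \<noteq> 0" using fin by (auto simp: poly_prod)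
  ultimately show ?thesis using assms by simp
qed

lemma sign_right_of_root:
  fixes f :: "real poly"
  assumes root: "poly f z = 0" "poly (pderiv f) z \<noteq> 0"
    and b: "z < b" "\<And>x. z < x \<Longrightarrow> x \<le> b \<Longrightarrow> poly f x \<noteq> 0"
  shows "poly f b * poly (pderiv f) z > 0"
proof (rule ccontr)
  assume "\<not> ?thesis"
  then have neg: "poly f b * poly (pderiv f) z < 0" using assms by (auto simp: not_less le_less)
  have D: "(poly f has_real_derivative poly (pderiv f) z) (at z)" by (rule poly_DERIV)
  consider "poly (pderiv f) z > 0" "poly f b < 0" | "poly (pderiv f) z < 0" "poly f b > 0"
    using neg by (auto simp: mult_less_0_iff)
  then obtain d where d: "d > 0" "\<And>h. 0 < h \<Longrightarrow> h < d \<Longrightarrow> poly f (z + h) * poly f b < 0"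
    by cases (use DERIV_pos_inc_right[OF D] DERIV_neg_dec_right[OF D] root in
      \<open>auto simp: mult_less_0_iff\<close>)
  define h where "h = min (d / 2) ((b - z) / 2)"
  have h: "0 < h" "h < d" "z + h < b" using d b by (auto simp: h_def min_def field_simps)
  then obtain x where "x > z + h" "x < b" "poly f x = 0" using poly_IVT d by blast
  then show False using b h by auto
qed

lemma sign_left_of_root:
  fixes f :: "real poly"
  assumes root: "poly f z = 0" "poly (pderiv f) z \<noteq> 0"
    and b: "b < z" "\<And>x. b \<le> x \<Longrightarrow> x < z \<Longrightarrow> poly f x \<noteq> 0"
  shows "poly f b * poly (pderiv f) z < 0"
proof (rule ccontr)
  assume "\<not> ?thesis"
  then have pos: "poly f b * poly (pderiv f) z > 0" using assms by (auto simp: not_less le_less)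
  have D: "(poly f has_real_derivative poly (pderiv f) z) (at z)" by (rule poly_DERIV)
  consider "poly (pderiv f) z > 0" "poly f b > 0" | "poly (pderiv f) z < 0" "poly f b < 0"
    using pos by (auto simp: zero_less_mult_iff)
  then obtain d where d: "d > 0" "\<And>h. 0 < h \<Longrightarrow> h < d \<Longrightarrow> poly f b * poly f (z - h) < 0"
    by cases (use DERIV_pos_inc_left[OF D] DERIV_neg_dec_left[OF D] root in
      \<open>auto simp: mult_less_0_iff\<close>)
  define h where "h = min (d / 2) ((z - b) / 2)"
  have h: "0 < h" "h < d" "b < z - h" using d b by (auto simp: h_def min_def field_simps)
  then obtain x where "x > b" "x < z - h" "poly f x = 0" using poly_IVT d by blast
  then show False using b h by auto
qed

text \<open>The derivative of \<open>f\<close> has opposite signs at consecutive simple roots of \<open>f\<close>, hence so has any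
  \<open>g\<close> whose sign relative to it is the same at both.\<close>

lemma root_between_consecutive_roots:
  fixes f g :: "real poly"
  assumes z: "poly f z = 0" "poly f z' = 0" "z < z'"
    and gap: "\<And>x. z < x \<Longrightarrow> x < z' \<Longrightarrow> poly f x \<noteq> 0"
    and simple: "poly (pderiv f) z \<noteq> 0" "poly (pderiv f) z' \<noteq> 0"
    and same: "(poly g z * poly (pderiv f) z) * (poly g z' * poly (pderiv f) z') > 0"
  shows "\<exists>w. z < w \<and> w < z' \<and> poly g w = 0"
proof -
  \<comment> \<open>The sign of \<open>f\<close> on the whole gap is read off at its midpoint.\<close>
  define b where "b = (z + z') / 2"
  have b: "z < b" "b < z'" using z by (auto simp: b_def)
  have "poly f b * poly (pderiv f) z > 0"
    using gap b z simple by (intro sign_right_of_root) auto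
  moreover have "poly f b * poly (pderiv f) z' < 0"
    using gap b z simple by (intro sign_left_of_root) auto
  ultimately have "poly (pderiv f) z * poly (pderiv f) z' < 0"
    by (auto simp: zero_less_mult_iff mult_less_0_iff)
  then have "poly g z * poly g z' < 0"
    using same by (auto simp: zero_less_mult_iff mult_less_0_iff)
  then show ?thesis using poly_IVT[OF z(3)] by blast
qed

lemma odd_degree_negative:
  fixes p :: "real poly"
  assumes "odd (degree p)" "lead_coeff p > 0"
  shows "\<exists>x<c. poly p x < 0"
proof -
  let ?q = "- (p \<circ>\<^sub>p [:0, -1:])"
  have "lead_coeff (p \<circ>\<^sub>p [:0, -1:]) = - lead_coeff p"
    using assms(1) by (subst lead_coeff_comp) auto
  then have pos: "lead_coeff ?q > 0" using assms(2) by simp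
  then obtain n where n: "\<And>x. x \<ge> n \<Longrightarrow> lead_coeff ?q \<le> poly ?q x"
    using poly_pinfty_gt_lc by blast
  define x where "x = max n (1 - c)"
  have "poly p (- x) < 0" using n[of x] pos by (simp add: x_def poly_pcompose)
  moreover have "- x < c" by (auto simp: x_def)
  ultimately show ?thesis by blast
qed

section \<open>Polynomials with simple negative roots\<close>

text \<open>The positivity conditions fix the sign at \<open>0\<close> and at infinity.\<close>

definition neg_simple :: "real poly \<Rightarrow> bool" where
  "neg_simple f \<longleftrightarrow>
     poly f 0 > 0 \<and> lead_coeff f > 0 \<and> card {x. x < 0 \<and> poly f x = 0} = degree f"

lemma neg_simple_facts:
  assumes "neg_simple f"
  shows "f \<noteq> 0" "finite {x. x < 0 \<and> poly f x = 0}"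
    "{x. poly f x = 0} = {x. x < 0 \<and> poly f x = 0}"
    "poly f z = 0 \<Longrightarrow> z < 0" "poly f z = 0 \<Longrightarrow> poly (pderiv f) z \<noteq> 0"
proof -
  show nz: "f \<noteq> 0" using assms by (auto simp: neg_simple_def)
  have fin: "finite {x. poly f x = 0}" using nz by (rule poly_roots_finite)
  then show "finite {x. x < 0 \<and> poly f x = 0}" by (rule finite_subset[rotated]) auto
  show eq: "{x. poly f x = 0} = {x. x < 0 \<and> poly f x = 0}"
  proof (rule card_subset_eq[OF fin, symmetric])
    have "card {x. x < 0 \<and> poly f x = 0} \<le> card {x. poly f x = 0}"
      using fin by (intro card_mono) auto
    then show "card {x. x < 0 \<and> poly f x = 0} = card {x. poly f x = 0}"
      using card_poly_roots_bound[OF nz] assms by (simp add: neg_simple_def)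
  qed auto
  then show "poly f z = 0 \<Longrightarrow> z < 0" by auto
  show "poly f z = 0 \<Longrightarrow> poly (pderiv f) z \<noteq> 0"
    using nz eq assms by (intro pderiv_nz_at_root) (auto simp: neg_simple_def)
qed

lemma neg_simple_card_ge:
  assumes "poly g 0 > 0" "lead_coeff g > 0" "degree g \<le> card A" "finite A"
    "A \<subseteq> {x. x < 0 \<and> poly g x = 0}"
  shows "neg_simple g"
proof -
  have nz: "g \<noteq> 0" using assms by auto
  have fin: "finite {x. poly g x = 0}" using nz by (rule poly_roots_finite)
  have "card A \<le> card {x. x < 0 \<and> poly g x = 0}"
    using assms(5) fin by (intro card_mono) (auto intro: finite_subset[rotated])
  moreover have "card {x. x < 0 \<and> poly g x = 0} \<le> card {x. poly g x = 0}"
    using fin by (intro card_mono) auto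
  ultimately show ?thesis
    using card_poly_roots_bound[OF nz] assms by (simp add: neg_simple_def)
qed

text \<open>The sign condition makes \<open>g\<close> change sign between consecutive roots of \<open>f\<close> and between the
  last one and \<open>0\<close>; if its degree is larger than that of
  \<open>f\<close>, also to the left of all roots of \<open>f\<close>. These roots exhaust its degree.\<close>

lemma neg_simple_step:
  assumes f: "neg_simple f" and g: "poly g 0 > 0" "lead_coeff g > 0"
    and sign: "\<And>z. poly f z = 0 \<Longrightarrow> poly g z * poly (pderiv f) z < 0"
    and deg: "degree g = degree f \<or> degree g = degree f + 1"
  shows "neg_simple g"
proof -
  define R where "R = {x. x < 0 \<and> poly f x = 0}"
  note f_facts = neg_simple_facts[OF f]
  have R: "finite R" "card R = degree f" "\<And>x. poly f x = 0 \<longleftrightarrow> x \<in> R"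
    using f_facts(2,3) f by (auto simp: R_def neg_simple_def)
  have Rneg: "x < 0" if "x \<in> R" for x using that by (simp add: R_def)
  have "\<exists>w. z < w \<and> w < 0 \<and> poly g w = 0 \<and> (\<forall>x\<in>R. x \<le> z \<or> w < x)" if z: "z \<in> R" for z
  proof (cases "\<exists>x\<in>R. z < x")
    case False
    have "poly f 0 * poly (pderiv f) z > 0"
      using z False R f_facts(4,5) f by (intro sign_right_of_root) (auto dest: Rneg simp: neg_simple_def)
    then have "poly (pderiv f) z > 0" using f by (auto simp: neg_simple_def zero_less_mult_iff)
    then have "poly g z < 0" using sign[of z] z R by (auto simp: mult_less_0_iff)
    then obtain w where "z < w" "w < 0" "poly g w = 0"
      using poly_IVT_pos[of z 0 g] g z by (auto dest: Rneg)
    then show ?thesis using False by (intro exI[of _ w]) (auto simp: not_less)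
  next
    case True
    define z' where "z' = Min {x \<in> R. z < x}"
    have ne: "{x \<in> R. z < x} \<noteq> {}" and fin: "finite {x \<in> R. z < x}" using True R by auto
    have z': "z' \<in> R" "z < z'" using Min_in[OF fin ne] by (auto simp: z'_def)
    have min: "x \<in> R \<Longrightarrow> z < x \<Longrightarrow> z' \<le> x" for x
      using fin by (auto simp: z'_def intro: Min_le)
    have "\<exists>w. z < w \<and> w < z' \<and> poly g w = 0"
    proof (rule root_between_consecutive_roots[of f])
      show "(poly g z * poly (pderiv f) z) * (poly g z' * poly (pderiv f) z') > 0"
        using sign[of z] sign[of z'] z z' R by (intro mult_neg_neg) auto
      show "poly f x \<noteq> 0" if "z < x" "x < z'" for x using min[of x] that R by auto
    qed (use z z' R f_facts in auto)
    then obtain w where "z < w" "w < z'" "poly g w = 0" by blast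
    moreover have "x \<le> z \<or> w < x" if "x \<in> R" for x using min[OF that] \<open>w < z'\<close> by force
    ultimately show ?thesis using Rneg[OF z'(1)] by (intro exI[of _ w]) auto
  qed
  then obtain h where h: "\<And>z. z \<in> R \<Longrightarrow>
      z < h z \<and> h z < 0 \<and> poly g (h z) = 0 \<and> (\<forall>x\<in>R. x \<le> z \<or> h z < x)" by metis
  have inj: "inj_on h R"
  proof (rule inj_onI)
    fix x y assume xy: "x \<in> R" "y \<in> R" "h x = h y"
    have "\<not> x < y" "\<not> y < x" using h[OF xy(1)] h[OF xy(2)] xy by force+
    then show "x = y" by simp
  qed
  show ?thesis
  proof (cases "degree g = degree f")
    case True
    show ?thesis
      by (rule neg_simple_card_ge[of g "h ` R"]) (use g R h True card_image[OF inj] in auto)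
  next
    case False
    then have deg': "degree g = degree f + 1" using deg by simp
    \<comment> \<open>Far to the left the signs of \<open>f\<close> and \<open>g\<close> differ, as \<open>f g\<close> has odd degree.\<close>
    have lead: "lead_coeff (f * g) > 0"
      using f g by (simp add: lead_coeff_mult neg_simple_def)
    have "odd (degree (f * g))"
      using deg' f_facts(1) g by (subst degree_mult_eq) auto
    then obtain X where X: "X < Min (insert 0 R)" "poly (f * g) X < 0"
      using odd_degree_negative[OF _ lead] by blast
    have XR: "X < 0" "\<And>z. z \<in> R \<Longrightarrow> X < z" using X R by auto
    have "\<exists>w. X < w \<and> w < 0 \<and> poly g w = 0 \<and> (\<forall>z\<in>R. w < z)"
    proof (cases "R = {}")
      case True
      have "poly f X > 0"
      proof (rule ccontr)
        assume "\<not> ?thesis"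
        moreover have "poly f X \<noteq> 0" using R True by auto
        ultimately have "poly f X < 0" by simp
        then show False using poly_IVT_pos[of X 0 f] XR f R True by (auto simp: neg_simple_def)
      qed
      then have "poly g X < 0" using X by (simp add: mult_less_0_iff)
      then show ?thesis using poly_IVT_pos[of X 0 g] XR g True by auto
    next
      case False
      define z where "z = Min R"
      have z: "z \<in> R" "\<And>x. x \<in> R \<Longrightarrow> z \<le> x" using False R by (auto simp: z_def)
      have "poly f X * poly (pderiv f) z < 0"
        using z XR R f_facts(5) by (intro sign_left_of_root) (force simp: not_le)+
      then have "poly g X * poly g z < 0"
        using X sign[of z] z R by (auto simp: mult_less_0_iff zero_less_mult_iff)
      then obtain w where "X < w" "w < z" "poly g w = 0"
        using poly_IVT[of X z g] XR z by auto
      then have "w < 0" "\<forall>x\<in>R. w < x" using z Rneg[OF z(1)] by force+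
      then show ?thesis using \<open>X < w\<close> \<open>poly g w = 0\<close> by blast
    qed
    then obtain w where w: "w < 0" "poly g w = 0" "\<And>z. z \<in> R \<Longrightarrow> w < z" by blast
    have "w \<notin> h ` R"
    proof
      assume "w \<in> h ` R"
      then obtain z where "z \<in> R" "w = h z" by blast
      then show False using h[of z] w(3)[of z] by simp
    qed
    then show ?thesis
      by (intro neg_simple_card_ge[of g "insert w (h ` R)"])
        (use g R h w deg' card_image[OF inj] in auto)
  qed
qed

section \<open>Diagonal operators\<close>

text \<open>The operator \<open>\<phi> (y d/dy)\<close>: monomials are the eigenvectors of \<open>y d/dy\<close>.\<close>

definition diag :: "real poly \<Rightarrow> real poly \<Rightarrow> real poly" where
  "diag \<phi> f = (\<Sum>i\<le>degree f. monom (poly \<phi> (real i) * coeff f i) i)"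

lemma coeff_diag [simp]: "coeff (diag \<phi> f) i = poly \<phi> (real i) * coeff f i"
  by (simp add: diag_def coeff_sum coeff_monom coeff_eq_0)

lemma diag_mult: "diag (\<phi> * \<psi>) f = diag \<phi> (diag \<psi> f)"
  by (rule poly_eqI) simp

lemma diag_add: "diag (\<phi> + \<psi>) f = diag \<phi> f + diag \<psi> f"
  by (rule poly_eqI) (simp add: algebra_simps)

lemma diag_smult: "diag (smult c \<phi>) f = smult c (diag \<phi> f)"
  by (rule poly_eqI) simp

lemma diag_sum: "diag (\<Sum>x\<in>A. \<phi> x) f = (\<Sum>x\<in>A. diag (\<phi> x) f)"
  by (rule poly_eqI) (simp add: coeff_sum poly_sum sum_distrib_right)

lemma diag_1 [simp]: "diag 1 f = f"
  by (rule poly_eqI) simp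

lemma diag_linear: "diag [:a, b:] f = smult a f + smult b (pCons 0 (pderiv f))"
proof (rule poly_eqI)
  show "coeff (diag [:a, b:] f) i = coeff (smult a f + smult b (pCons 0 (pderiv f))) i" for i
    by (cases i) (simp_all add: coeff_pderiv algebra_simps)
qed

lemma poly_diag_linear: "poly (diag [:a, b:] f) z = a * poly f z + b * z * poly (pderiv f) z"
  by (simp add: diag_linear)

lemma neg_simple_smult: "neg_simple f \<Longrightarrow> c > 0 \<Longrightarrow> neg_simple (smult c f)"
  by (simp add: neg_simple_def)

text \<open>At a root \<open>z\<close> of \<open>f\<close> the new polynomial \<open>\<rho> f + y f'\<close> takes the value \<open>z f' z\<close>, and \<open>z\<close> is
  negative.\<close>

lemma neg_simple_diag_linear:
  assumes f: "neg_simple f" and \<rho>: "\<rho> > 0"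
  shows "neg_simple (diag [:\<rho>, 1:] f)"
proof (rule neg_simple_step[OF f])
  have deg: "degree (diag [:\<rho>, 1:] f) = degree f"
  proof (rule antisym)
    show "degree (diag [:\<rho>, 1:] f) \<le> degree f"
      by (rule degree_le) (simp add: coeff_eq_0)
    show "degree f \<le> degree (diag [:\<rho>, 1:] f)"
      by (rule le_degree) (use f \<rho> in \<open>auto simp: neg_simple_def add_nonneg_eq_0_iff\<close>)
  qed
  then show "degree (diag [:\<rho>, 1:] f) = degree f \<or> degree (diag [:\<rho>, 1:] f) = degree f + 1" by simp
  show "lead_coeff (diag [:\<rho>, 1:] f) > 0"
    unfolding deg using f \<rho> by (simp add: neg_simple_def add_pos_nonneg)
  show "poly (diag [:\<rho>, 1:] f) 0 > 0" using f \<rho> by (simp add: poly_diag_linear neg_simple_def)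
  show "poly (diag [:\<rho>, 1:] f) z * poly (pderiv f) z < 0" if "poly f z = 0" for z
    using that neg_simple_facts(4,5)[OF f that]
    by (simp add: poly_diag_linear mult.assoc mult_neg_pos flip: power2_eq_square)
qed

text \<open>The difference of the two sides is \<open>f\<^sup>2\<close> times the sum of the squares of the terms
  \<open>1 / (x - z)\<close>, which is minus the derivative of \<open>f' / f\<close>.\<close>

lemma laguerre_inequality:
  fixes x :: real
  assumes "finite Z"
  defines "f \<equiv> \<Prod>z\<in>Z. [:-z, 1:]"
  shows "poly f x * poly (pderiv (pderiv f)) x \<le> (poly (pderiv f) x)\<^sup>2 \<and>
    (Z \<noteq> {} \<longrightarrow> poly f x \<noteq> 0 \<longrightarrow> poly f x * poly (pderiv (pderiv f)) x < (poly (pderiv f) x)\<^sup>2)"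
  using assms(1) unfolding f_def
proof (induction Z)
  case (insert w Z)
  let ?h = "\<Prod>z\<in>Z. [:-z, 1:]" and ?f = "\<Prod>z\<in>insert w Z. [:-z, 1:]"
  have f: "?f = [:-w, 1:] * ?h" using insert.hyps by simp
  have 0: "poly ?f x = (x - w) * poly ?h x" unfolding f by (simp add: algebra_simps)
  have d1: "pderiv ?f = ?h + [:-w, 1:] * pderiv ?h"
    unfolding f pderiv_mult by (simp add: pderiv_pCons)
  have 1: "poly (pderiv ?f) x = poly ?h x + (x - w) * poly (pderiv ?h) x"
    unfolding d1 by (simp add: algebra_simps)
  have 2: "poly (pderiv (pderiv ?f)) x = 2 * poly (pderiv ?h) x + (x - w) * poly (pderiv (pderiv ?h)) x"
    unfolding d1 pderiv_add pderiv_mult by (simp add: pderiv_pCons algebra_simps)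
  have "(poly (pderiv ?f) x)\<^sup>2 - poly ?f x * poly (pderiv (pderiv ?f)) x =
      (poly ?h x)\<^sup>2 + (x - w)\<^sup>2 * ((poly (pderiv ?h) x)\<^sup>2 - poly ?h x * poly (pderiv (pderiv ?h)) x)"
    unfolding 0 1 2 by (simp add: power2_eq_square algebra_simps)
  moreover have "(x - w)\<^sup>2 * ((poly (pderiv ?h) x)\<^sup>2 - poly ?h x * poly (pderiv (pderiv ?h)) x) \<ge> 0"
    using insert.IH by (intro mult_nonneg_nonneg) auto
  moreover have "(poly ?h x)\<^sup>2 \<ge> 0" "poly ?f x \<noteq> 0 \<longrightarrow> (poly ?h x)\<^sup>2 > 0" by (auto simp: 0)
  ultimately show ?case by linarith
qed simp

text \<open>With \<open>\<rho> f + y f' = 0\<close> at \<open>z\<close>, the product of \<open>f\<close> and the derivative of \<open>\<rho> f + y f'\<close> equals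
  \<open>- z f'\<^sup>2 / \<rho> - z (f'\<^sup>2 - f f'')\<close>.\<close>

lemma diag_linear_sign:
  assumes f: "neg_simple f" and \<rho>: "\<rho> > 0" and z: "poly (diag [:\<rho>, 1:] f) z = 0"
  shows "poly f z * poly (pderiv (diag [:\<rho>, 1:] f)) z > 0"
proof -
  let ?a = "poly f z" and ?b = "poly (pderiv f) z" and ?c = "poly (pderiv (pderiv f)) z"
  note f_facts = neg_simple_facts[OF f]
  have z0: "z < 0" using neg_simple_facts(4)[OF neg_simple_diag_linear[OF f \<rho>] z] .
  have eq: "\<rho> * ?a = - (z * ?b)" using z by (simp add: poly_diag_linear)
  have a: "?a \<noteq> 0"
  proof
    assume "?a = 0"
    then show False using eq f_facts(5)[of z] z0 by simp
  qed
  have d: "poly (pderiv (diag [:\<rho>, 1:] f)) z = (\<rho> + 1) * ?b + z * ?c"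
    by (simp add: diag_linear pderiv_add pderiv_smult pderiv_pCons algebra_simps)
  have lag: "?a * ?c < ?b\<^sup>2"
  proof -
    let ?Z = "{x. poly f x = 0}" and ?l = "lead_coeff f"
    let ?g = "\<Prod>z\<in>?Z. [:-z, 1:]"
    have card: "card ?Z = degree f" using f_facts(3) f by (simp add: neg_simple_def)
    have fin: "finite ?Z" using f_facts(2,3) by simp
    have fg: "f = smult ?l ?g" by (rule eq_prod_roots) (use card fin in auto)
    have "?Z \<noteq> {}"
    proof
      assume "?Z = {}"
      then obtain c where "f = [:c:]" using card degree_eq_zeroE[of f] by auto
      then show False using z a \<rho> by (auto simp: poly_diag_linear pderiv_pCons)
    qed
    moreover have "poly ?g z \<noteq> 0" using a fg by (metis mult_zero_right poly_smult)
    ultimately have "poly ?g z * poly (pderiv (pderiv ?g)) z < (poly (pderiv ?g) z)\<^sup>2"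
      using laguerre_inequality[OF fin, of z] by blast
    moreover have "?l\<^sup>2 > 0" using f_facts(1) by simp
    ultimately have "?l\<^sup>2 * (poly ?g z * poly (pderiv (pderiv ?g)) z) < ?l\<^sup>2 * (poly (pderiv ?g) z)\<^sup>2"
      by (rule mult_strict_left_mono)
    moreover have "?a = ?l * poly ?g z" "?b = ?l * poly (pderiv ?g) z"
      "?c = ?l * poly (pderiv (pderiv ?g)) z"
      by (subst fg, simp add: pderiv_smult)+
    ultimately show ?thesis by (simp only: power2_eq_square mult_ac)
  qed
  have "\<rho> * (?a * ?b) = - z * ?b\<^sup>2" using eq by (simp add: power2_eq_square flip: mult.assoc)
  then have "\<rho> * (?a * ?b) \<ge> 0" using z0 by (simp add: mult_nonpos_nonneg)
  then have ab: "?a * ?b \<ge> 0" using \<rho> by (simp add: zero_le_mult_iff)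
  have "?a * ((\<rho> + 1) * ?b + z * ?c) = \<rho> * (?a * ?b) + ?a * ?b + z * (?a * ?c)"
    by (simp add: algebra_simps)
  also have "\<dots> = ?a * ?b + (- z) * (?b\<^sup>2 - ?a * ?c)"
    unfolding \<open>\<rho> * (?a * ?b) = - z * ?b\<^sup>2\<close> by (simp add: algebra_simps)
  also have "\<dots> > 0" using ab lag z0 by (intro add_nonneg_pos mult_pos_pos) auto
  finally show ?thesis unfolding d .
qed

lemma neg_simple_diag_prod:
  assumes "finite S" "\<And>\<rho>. \<rho> \<in> S \<Longrightarrow> \<rho> > 0" "neg_simple f"
  shows "neg_simple (diag (\<Prod>\<rho>\<in>S. [:\<rho>, 1:]) f)"
  using assms
proof (induction S)
  case (insert \<rho> S)
  then have "neg_simple (diag [:\<rho>, 1:] (diag (\<Prod>\<rho>\<in>S. [:\<rho>, 1:]) f))"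
    by (intro neg_simple_diag_linear) auto
  then show ?case unfolding prod.insert[OF insert.hyps] diag_mult .
qed simp

text \<open>Lagrange interpolation at the roots \<open>- \<rho>\<close> of \<open>N\<close>, after removal of a multiple of \<open>N\<close> by a
  polynomial of degree at most \<open>1\<close>.\<close>

lemma partial_fraction_decomposition:
  fixes S :: "real set" and R :: "real poly"
  assumes S: "finite S" and a: "a \<noteq> 0"
    and deg: "degree R \<le> card S + 1"
  defines "N \<equiv> smult a (\<Prod>\<rho>\<in>S. [:\<rho>, 1:])" and "N' \<equiv> \<lambda>\<rho>. smult a (\<Prod>\<sigma>\<in>S - {\<rho>}. [:\<sigma>, 1:])"
  shows "\<exists>\<beta>. R = [:\<beta>, coeff R (card S + 1) / a:] * N +
    (\<Sum>\<rho>\<in>S. smult (poly R (- \<rho>) / poly (N' \<rho>) (- \<rho>)) (N' \<rho>))"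
proof -
  let ?k = "card S" and ?c = "\<lambda>\<rho>. poly R (- \<rho>) / poly (N' \<rho>) (- \<rho>)"
  have degN: "degree N = ?k" "coeff N ?k = a"
  proof -
    have d: "degree (\<Prod>\<rho>\<in>S. [:\<rho>, 1:]) = ?k" by (subst degree_prod_sum_eq) auto
    have "lead_coeff (\<Prod>\<rho>\<in>S. [:\<rho>, 1:]) = 1" by (simp add: lead_coeff_prod)
    then show "degree N = ?k" "coeff N ?k = a" using d a by (simp_all add: N_def)
  qed
  have degN': "degree (N' \<rho>) < ?k" if "\<rho> \<in> S" for \<rho>
  proof -
    have "degree (\<Prod>\<sigma>\<in>S - {\<rho>}. [:\<sigma>, 1:]) = card (S - {\<rho>})" by (subst degree_prod_sum_eq) auto
    moreover have "card (S - {\<rho>}) < card S" using S that by (rule card_Diff1_less)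
    ultimately show ?thesis using a by (simp add: N'_def)
  qed
  \<comment> \<open>\<open>T\<close> has degree at most that of \<open>N\<close> and vanishes at all roots of \<open>N\<close>.\<close>
  define T where "T = R - [:0, coeff R (?k + 1) / a:] * N - (\<Sum>\<rho>\<in>S. smult (?c \<rho>) (N' \<rho>))"
  have coeffN': "coeff (\<Sum>\<rho>\<in>S. smult (?c \<rho>) (N' \<rho>)) i = 0" if "i \<ge> ?k" for i
    using degN' that by (auto simp: coeff_sum intro!: sum.neutral coeff_eq_0 less_le_trans[OF degN'])
  have "coeff T i = 0" if gt: "i > ?k" for i
  proof -
    consider "i = ?k + 1" | "i > ?k + 1" using gt by linarith
    then show ?thesis
    proof cases
      case 1
      then show ?thesis using coeffN'[of i] a degN by (simp add: T_def coeff_eq_0)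
    next
      case 2
      then have "coeff R i = 0" "coeff N i = 0" "coeff N (i - 1) = 0"
        using deg degN by (auto intro!: coeff_eq_0)
      then show ?thesis using coeffN'[of i] 2 by (cases i) (simp_all add: T_def)
    qed
  qed
  then have degT: "degree T \<le> ?k" by (intro degree_le) auto
  have "T = smult (coeff T ?k / a) N"
  proof (rule poly_eqI_degree_lead_coeff[of _ ?k _ "uminus ` S"])
    show "coeff T ?k = coeff (smult (coeff T ?k / a) N) ?k" using degN a by simp
    show "card (uminus ` S) \<ge> ?k" by (simp add: card_image inj_on_def)
    show "degree (smult (coeff T ?k / a) N) \<le> ?k" using degN by (simp add: degree_smult_le)
    fix z assume "z \<in> uminus ` S"
    then obtain \<rho> where \<rho>: "\<rho> \<in> S" "z = - \<rho>" by auto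
    have N0: "poly N z = 0" using \<rho> S by (auto simp: N_def poly_prod)
    have "poly (N' \<sigma>) z = 0" if "\<sigma> \<in> S - {\<rho>}" for \<sigma>
      using that \<rho> S by (auto simp: N'_def poly_prod)
    then have "(\<Sum>\<sigma>\<in>S. ?c \<sigma> * poly (N' \<sigma>) z) = ?c \<rho> * poly (N' \<rho>) z"
      using S \<rho> by (subst sum.remove[of S \<rho>]) auto
    moreover have "poly (N' \<rho>) z \<noteq> 0" using a \<rho> S by (auto simp: N'_def poly_prod)
    ultimately have "(\<Sum>\<sigma>\<in>S. ?c \<sigma> * poly (N' \<sigma>) z) = poly R z" using \<rho> by simp
    then show "poly T z = poly (smult (coeff T ?k / a) N) z"
      using N0 by (simp add: T_def poly_sum)
  qed (rule degT)
  then have "R = [:coeff T ?k / a, coeff R (?k + 1) / a:] * N + (\<Sum>\<rho>\<in>S. smult (?c \<rho>) (N' \<rho>))"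
    unfolding T_def by (simp add: algebra_simps)
  then show ?thesis by blast
qed

text \<open>By partial fractions, \<open>R (y d/dy) f\<close> is a combination of \<open>p = N (y d/dy) f\<close>, of \<open>y p'\<close> and of the
  polynomials \<open>f\<^sub>\<rho>\<close> with \<open>\<rho> f\<^sub>\<rho> + y f\<^sub>\<rho>' = p\<close>. At a root of \<open>p\<close> the first of these vanishes, and
  all others contribute with the sign of \<open>p'\<close>.\<close>

lemma diag_interlacing_sign:
  fixes S :: "real set"
  assumes f: "neg_simple f" and S: "finite S" "\<And>\<rho>. \<rho> \<in> S \<Longrightarrow> \<rho> > 0" and a: "a > 0"
  defines "N \<equiv> smult a (\<Prod>\<rho>\<in>S. [:\<rho>, 1:])"
  assumes deg: "degree R \<le> card S + 1" "coeff R (card S + 1) < 0"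
    and sign: "\<And>\<rho>. \<rho> \<in> S \<Longrightarrow> poly R (- \<rho>) * poly (pderiv N) (- \<rho>) > 0"
    and z: "poly (diag N f) z = 0"
  shows "poly (diag R f) z * poly (pderiv (diag N f)) z > 0"
proof -
  define p where "p = diag N f"
  define N' where "N' = (\<lambda>\<rho>. smult a (\<Prod>\<sigma>\<in>S - {\<rho>}. [:\<sigma>, 1:]))"
  have p: "neg_simple p"
    unfolding p_def N_def diag_smult using S f a
    by (intro neg_simple_smult neg_simple_diag_prod) auto
  have z0: "z < 0" "poly (pderiv p) z \<noteq> 0"
    using neg_simple_facts(4,5)[OF p] z by (auto simp: p_def)
  have NN': "N = [:\<rho>, 1:] * N' \<rho>" if "\<rho> \<in> S" for \<rho>
    unfolding N_def N'_def using S that by (simp only: prod.remove[of S \<rho>] mult_smult_right)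
  have f\<rho>: "poly (diag (N' \<rho>) f) z * poly (pderiv p) z > 0" if "\<rho> \<in> S" for \<rho>
  proof -
    have "neg_simple (diag (N' \<rho>) f)"
      unfolding N'_def diag_smult using S f a
      by (intro neg_simple_smult neg_simple_diag_prod) auto
    moreover have "p = diag [:\<rho>, 1:] (diag (N' \<rho>) f)"
      unfolding p_def NN'[OF that] diag_mult ..
    ultimately show ?thesis using diag_linear_sign[of "diag (N' \<rho>) f" \<rho> z] S that z
      by (simp add: p_def)
  qed
  have c: "poly R (- \<rho>) / poly (N' \<rho>) (- \<rho>) > 0" if "\<rho> \<in> S" for \<rho>
  proof -
    have "poly (pderiv N) (- \<rho>) = poly (N' \<rho>) (- \<rho>)"
      unfolding NN'[OF that] by (rule poly_pderiv_linear_mult)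
    then show ?thesis using sign[OF that] by (auto simp: zero_less_mult_iff zero_less_divide_iff)
  qed
  obtain \<beta> where R: "R = [:\<beta>, coeff R (card S + 1) / a:] * N +
      (\<Sum>\<rho>\<in>S. smult (poly R (- \<rho>) / poly (N' \<rho>) (- \<rho>)) (N' \<rho>))"
    using partial_fraction_decomposition[OF S(1) _ deg(1), of a] a unfolding N_def N'_def by auto
  define \<gamma> where "\<gamma> = (\<lambda>\<rho>. poly R (- \<rho>) / poly (N' \<rho>) (- \<rho>))"
  define l where "l = coeff R (card S + 1) / a"
  have l: "l < 0" using deg a by (simp add: l_def divide_neg_pos)
  have "diag R f = diag [:\<beta>, l:] p + (\<Sum>\<rho>\<in>S. smult (\<gamma> \<rho>) (diag (N' \<rho>) f))"
    by (subst R) (simp only: diag_add diag_mult diag_sum diag_smult p_def \<gamma>_def l_def)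
  then have "poly (diag R f) z * poly (pderiv p) z = l * z * (poly (pderiv p) z)\<^sup>2 +
      (\<Sum>\<rho>\<in>S. \<gamma> \<rho> * (poly (diag (N' \<rho>) f) z * poly (pderiv p) z))"
    using z by (simp add: poly_diag_linear p_def poly_sum algebra_simps sum_distrib_left power2_eq_square)
  also have "\<dots> > 0"
  proof (rule add_pos_nonneg)
    show "l * z * (poly (pderiv p) z)\<^sup>2 > 0" using l z0 by (simp add: mult_neg_neg)
    show "(\<Sum>\<rho>\<in>S. \<gamma> \<rho> * (poly (diag (N' \<rho>) f) z * poly (pderiv p) z)) \<ge> 0"
    proof (rule sum_nonneg)
      fix \<rho> assume "\<rho> \<in> S"
      then show "\<gamma> \<rho> * (poly (diag (N' \<rho>) f) z * poly (pderiv p) z) \<ge> 0"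
        using mult_pos_pos[OF c[OF \<open>\<rho> \<in> S\<close>] f\<rho>[OF \<open>\<rho> \<in> S\<close>]] by (simp add: \<gamma>_def)
    qed
  qed
  finally show ?thesis by (simp add: p_def)
qed

section \<open>The polynomials of Gegenbauer type\<close>

text \<open>Up to a constant factor, \<open>x\<^sup>e\<close> times the value of this polynomial at \<open>(x\<^sup>2 - 1) / (4 x\<^sup>2)\<close> is the
  Gegenbauer polynomial of degree \<open>e\<close> and parameter \<open>n + 3/2\<close>.\<close>

definition gegenbauer :: "nat \<Rightarrow> nat \<Rightarrow> real poly" where
  "gegenbauer n e =
     (\<Sum>i\<le>e div 2. monom (fact e / (fact (e - 2 * i) * fact i * fact (i + n + 1))) i)"

lemma coeff_gegenbauer:
  "coeff (gegenbauer n e) i =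
     (if 2 * i \<le> e then fact e / (fact (e - 2 * i) * fact i * fact (i + n + 1)) else 0)"
proof -
  have "i \<le> e div 2 \<longleftrightarrow> 2 * i \<le> e" by auto
  then show ?thesis by (simp add: gegenbauer_def coeff_sum coeff_monom del: fact_Suc)
qed

lemma degree_gegenbauer: "degree (gegenbauer n e) = e div 2"
proof (rule antisym)
  show "degree (gegenbauer n e) \<le> e div 2" by (rule degree_le) (auto simp: coeff_gegenbauer)
  show "e div 2 \<le> degree (gegenbauer n e)" by (rule le_degree) (simp add: coeff_gegenbauer)
qed

lemma gegenbauer_pos: "poly (gegenbauer n e) 0 > 0" "lead_coeff (gegenbauer n e) > 0"
  by (simp_all add: poly_0_coeff_0 degree_gegenbauer coeff_gegenbauer)

lemma gegenbauer_lower: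
  assumes "e \<ge> 1"
  shows "gegenbauer n (e - 1) = diag [:1, - 2 / real e:] (gegenbauer n e)"
proof (rule poly_eqI)
  fix i
  consider "2 * i \<le> e - 1" | "2 * i = e" | "2 * i > e" by linarith
  then show "coeff (gegenbauer n (e - 1)) i = coeff (diag [:1, - 2 / real e:] (gegenbauer n e)) i"
  proof cases
    case 1
    then have le: "2 * i \<le> e" by simp
    have f: "fact (e - 2 * i) = (real e - 2 * real i) * fact (e - 1 - 2 * i)"
      using 1 assms by (subst fact_reduce) (auto simp: of_nat_diff algebra_simps)
    have g: "fact e = real e * fact (e - 1)" using assms by (subst fact_reduce) auto
    have nz: "real e - 2 * real i \<noteq> 0" using 1 assms by linarith
    have "(1 + real i * (- 2 / real e)) * (real e * u / ((real e - 2 * real i) * v * w * x)) = u / (v * w * x)"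
      if "v \<noteq> 0" "w \<noteq> 0" "x \<noteq> 0" for u v w x :: real
      using that nz assms by (simp add: field_simps)
    then show ?thesis using 1 le by (simp add: coeff_gegenbauer f g del: fact_Suc)
  next
    case 2
    then have "real i * 2 = real e" by (metis of_nat_mult of_nat_numeral mult.commute)
    then show ?thesis using 2 assms by (simp add: coeff_gegenbauer)
  next
    case 3
    then show ?thesis by (simp add: coeff_gegenbauer)
  qed
qed

text \<open>The three-term recurrence of the Gegenbauer polynomials. The factor \<open>1 - 4 y\<close> is positive for
  negative \<open>y\<close>, so the polynomials form a Sturm sequence on the negative half-line.\<close>

lemma gegenbauer_recurrence:
  assumes "e \<ge> 1"
  shows "smult (real e + 2 * real n + 3) (gegenbauer n (e + 1)) =
    smult (2 * real e + 2 * real n + 3) (gegenbauer n e) -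
    smult (real e) ([:1, -4:] * gegenbauer n (e - 1))"
proof (rule poly_eqI)
  fix i
  define A where "A i = fact i * (fact (i + n + 1) :: real)" for i
  have A: "A i > 0" for i by (simp add: A_def)
  have c: "coeff (gegenbauer n k) i = (if 2 * i \<le> k then fact k / (fact (k - 2 * i) * A i) else 0)" for k i
    by (simp add: coeff_gegenbauer A_def mult.assoc del: fact_Suc)
  have fe: "fact (e + 1) = (real e + 1) * fact e" "fact e = real e * fact (e - 1)"
    using assms by (simp, subst fact_reduce, auto)
  have lin: "coeff ([:1, -4:] * q) i = coeff q i - 4 * (if i = 0 then 0 else coeff q (i - 1))"
    for q :: "real poly" by (cases i) simp_all
  have main: "(real e + 2 * real n + 3) * coeff (gegenbauer n (e + 1)) i +
      real e * coeff (gegenbauer n (e - 1)) i =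
      (2 * real e + 2 * real n + 3) * coeff (gegenbauer n e) i +
      4 * real e * (if i = 0 then 0 else coeff (gegenbauer n (e - 1)) (i - 1))"
  proof (cases "2 * i \<le> e + 1")
    case False
    then have "\<not> 2 * (i - 1) \<le> e - 1" "\<not> 2 * i \<le> e" "\<not> 2 * i \<le> e - 1"
      using assms by linarith+
    then show ?thesis using False by (simp add: c)
  next
    case True
    define k where "k = e + 1 - 2 * i"
    \<comment> \<open>The common factor of all coefficients; what remains is an identity of polynomials in
      \<open>e\<close>, \<open>i\<close> and \<open>n\<close>.\<close>
    define F where "F = fact e / (fact k * A i)"
    have k: "real k = real e + 1 - 2 * real i" using True by (simp add: k_def of_nat_diff)
    have 1: "coeff (gegenbauer n (e + 1)) i = (real e + 1) * F"
      using True by (simp add: c F_def k_def)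
    have 2: "coeff (gegenbauer n e) i = real k * F"
    proof (cases "2 * i \<le> e")
      case le: True
      then have "k = Suc (e - 2 * i)" by (simp add: k_def)
      then have "fact k = real k * fact (e - 2 * i)" "real k \<noteq> 0" by simp_all
      then show ?thesis using le A[of i] by (simp add: c F_def)
    next
      case False
      then have "k = 0" by (simp add: k_def)
      then show ?thesis using False by (simp add: c)
    qed
    have 3: "real e * coeff (gegenbauer n (e - 1)) i = real k * (real k - 1) * F"
    proof (cases "2 * i \<le> e - 1")
      case le: True
      then have "k = Suc (Suc (e - 1 - 2 * i))" using assms by (simp add: k_def)
      then have "fact k = real k * ((real k - 1) * fact (e - 1 - 2 * i))" by simp
      moreover have "real k \<noteq> 0" "real k - 1 \<noteq> 0"
        using \<open>k = Suc (Suc (e - 1 - 2 * i))\<close> by auto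
      ultimately show ?thesis using le A[of i] by (simp add: c F_def fe(2))
    next
      case False
      then have "k = 0 \<or> k = 1" using True by (auto simp: k_def)
      then show ?thesis using False by (auto simp: c)
    qed
    have 4: "real e * (if i = 0 then 0 else coeff (gegenbauer n (e - 1)) (i - 1)) =
        real i * (real i + real n + 1) * F"
    proof (cases i)
      case (Suc j)
      have "A i = real i * (real i + real n + 1) * A j"
        unfolding A_def Suc by (simp add: algebra_simps)
      moreover have "real i \<noteq> 0" "real i + real n + 1 \<noteq> 0" using Suc by auto
      moreover have "2 * j \<le> e - 1" "e - 1 - 2 * j = k" using True Suc by (auto simp: k_def)
      ultimately show ?thesis using A[of j] Suc by (simp add: c F_def fe(2))
    qed simp
    have "(real e + 2 * real n + 3) * ((real e + 1) * F) + real k * (real k - 1) * F =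
        (2 * real e + 2 * real n + 3) * (real k * F) + 4 * (real i * (real i + real n + 1) * F)"
      unfolding k by (simp add: algebra_simps)
    then show ?thesis unfolding 1 2 using 3 4 by (simp add: mult.assoc)
  qed
  show "coeff (smult (real e + 2 * real n + 3) (gegenbauer n (e + 1))) i =
    coeff (smult (2 * real e + 2 * real n + 3) (gegenbauer n e) -
      smult (real e) ([:1, -4:] * gegenbauer n (e - 1))) i"
    unfolding coeff_smult coeff_diff lin using main by (simp add: algebra_simps)
qed

text \<open>At a root \<open>z < 0\<close> of the \<open>e\<close>-th polynomial \<open>f\<close>, its predecessor has the sign of \<open>f' z\<close>
  and, by the recurrence, its successor has the opposite sign.\<close>

lemma neg_simple_gegenbauer: "neg_simple (gegenbauer n e)"
proof (induction e)
  case 0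
  have "{x. x < 0 \<and> poly (gegenbauer n 0) x = 0} = {}"
    by (auto simp: gegenbauer_def monom_0)
  then have "card {x. x < 0 \<and> poly (gegenbauer n 0) x = 0} = 0" by (simp only: card.empty)
  then show ?case
    unfolding neg_simple_def using gegenbauer_pos[of n 0] degree_gegenbauer[of n 0] by simp
next
  case (Suc e)
  show ?case
  proof (cases "e = 0")
    case True
    have "gegenbauer n (Suc 0) = gegenbauer n 0" by (simp add: gegenbauer_def)
    then show ?thesis using Suc True by simp
  next
    case False
    let ?f = "gegenbauer n e" and ?g = "gegenbauer n (e + 1)"
    have "neg_simple ?g"
    proof (rule neg_simple_step[OF Suc])
      show "poly ?g 0 > 0" "lead_coeff ?g > 0" by (rule gegenbauer_pos)+
      show "degree ?g = degree ?f \<or> degree ?g = degree ?f + 1"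
        unfolding degree_gegenbauer by presburger
      fix z assume z: "poly ?f z = 0"
      have z0: "z < 0" "poly (pderiv ?f) z \<noteq> 0" using neg_simple_facts(4,5)[OF Suc z] by auto
      have "poly (gegenbauer n (e - 1)) z = - 2 / real e * z * poly (pderiv ?f) z"
        using False z by (subst gegenbauer_lower) (auto simp: poly_diag_linear)
      moreover have "(real e + 2 * real n + 3) * poly ?g z =
          - (real e * ((1 - 4 * z) * poly (gegenbauer n (e - 1)) z))"
        using arg_cong[OF gegenbauer_recurrence[of e n], of "\<lambda>p. poly p z"] False z
        by (simp add: algebra_simps)
      ultimately have "(real e + 2 * real n + 3) * (poly ?g z * poly (pderiv ?f) z) =
          2 * (1 - 4 * z) * z * (poly (pderiv ?f) z)\<^sup>2"
        using False by (simp add: power2_eq_square mult.assoc[symmetric])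
      also have "\<dots> < 0" using z0 by (intro mult_neg_pos mult_pos_neg) auto
      finally show "poly ?g z * poly (pderiv ?f) z < 0"
        by (simp add: mult_less_0_iff add_nonneg_pos not_less)
    qed
    then show ?thesis by simp
  qed
qed

section \<open>Roots of the multipliers\<close>

lemma pochhammer_neg_same: "pochhammer (- real k) k = (-1) ^ k * fact k"
  using pochhammer_minus[of "real k" k] by (simp add: pochhammer_fact)

lemma pochhammer_X: "degree (pochhammer [:0, 1::real:] k) = k" "lead_coeff (pochhammer [:0, 1::real:] k) = 1"
proof -
  have "degree (pochhammer [:0, 1::real:] k) = k \<and> lead_coeff (pochhammer [:0, 1::real:] k) = 1"
  proof (induction k)
    case (Suc k)
    have eq: "pochhammer [:0, 1::real:] (Suc k) = pochhammer [:0, 1:] k * [:real k, 1:]"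
      by (simp add: pochhammer_Suc of_nat_poly)
    have "pochhammer [:0, 1::real:] k \<noteq> 0" using Suc by auto
    then show ?case using Suc unfolding eq
      by (subst degree_mult_eq) (auto simp: lead_coeff_mult simp del: mult_pCons_right)
  qed simp
  then show "degree (pochhammer [:0, 1::real:] k) = k" "lead_coeff (pochhammer [:0, 1::real:] k) = 1"
    by auto
qed

lemma degree_numer: "degree (numer D n) \<le> n"
proof (induction n)
  case (Suc n)
  have "degree ([:real n + 2, 1:] * numer D n) \<le> Suc n"
    using Suc degree_mult_le[of "[:real n + 2, 1:]" "numer D n"] by simp
  moreover have "degree (smult c (pochhammer [:0, 1:] (n + 1))) \<le> Suc n" for c :: real
    using degree_smult_le[of c "pochhammer [:0, 1:] (n + 1)"] pochhammer_X(1)[of "n + 1"] by simp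
  ultimately show ?case by (simp only: numer.simps degree_add_le)
qed simp

lemma coeff_numer_pos: "coeff (numer D n) n > 0"
proof (induction n)
  case (Suc n)
  have "coeff ([:real n + 2, 1:] * numer D n) (Suc n) = coeff (numer D n) n"
    using degree_numer[of D n] by (simp add: coeff_eq_0)
  moreover have "coeff (pochhammer [:0, 1::real:] (n + 1)) (Suc n) = 1"
    using pochhammer_X[of "n + 1"] by simp
  ultimately show ?case using Suc by (simp only: numer.simps coeff_add coeff_smult)
qed simp

lemma poly_numer_Suc:
  "poly (numer D (Suc n)) x = (real n + 2 + x) * poly (numer D n) x +
     real ((D + n + 1) choose (n + 1)) * pochhammer x (n + 1)"
  by (simp only: numer.simps poly_add poly_mult poly_smult poly_pochhammer) simp

lemma poly_numer_pos: "x \<ge> 0 \<Longrightarrow> poly (numer D n) x > 0"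
proof (induction n)
  case (Suc n)
  have "pochhammer x (n + 1) \<ge> 0"
    unfolding pochhammer_prod using Suc.prems by (intro prod_nonneg) auto
  moreover have "(real n + 2 + x) * poly (numer D n) x > 0" using Suc by (intro mult_pos_pos) auto
  ultimately show ?case unfolding poly_numer_Suc by (intro add_pos_nonneg mult_nonneg_nonneg) auto
qed simp

text \<open>In the recursion for \<open>numer D (Suc n)\<close> the rising factorial vanishes at \<open>0, -1, \<dots>, -n\<close>. At
  \<open>- (n + 1)\<close> it does not, and the sign of the sum has to be found by comparing both terms.\<close>

lemma poly_numer_boundary:
  "poly (numer D n) (- real (n + 1)) = (-1) ^ n * real ((D + n) choose n) * fact (n + 1)"
proof (cases n)
  case (Suc k)
  have "pochhammer (- real (k + 2)) (k + 1) = (-1) ^ (k + 1) * pochhammer 2 (k + 1)"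
    using pochhammer_minus[of "real (k + 2)" "k + 1"] by simp
  moreover have "pochhammer (2::real) (k + 1) = fact (k + 2)"
    using pochhammer_rec[of "1::real" "k + 1"] by (simp add: pochhammer_fact[symmetric])
  ultimately have "pochhammer (- real (k + 2)) (k + 1) = (-1) ^ (k + 1) * fact (k + 2)" by simp
  then show ?thesis unfolding Suc poly_numer_Suc by (simp add: mult_ac del: pochhammer_Suc fact_Suc binomial_Suc_Suc)
qed simp

lemma numer_alternates:
  assumes "D \<ge> 1" "j \<le> n"
  shows "(-1) ^ j * poly (numer D n) (- real j) > 0"
  using assms(2)
proof (induction n)
  case (Suc n)
  show ?case
  proof (cases "j \<le> n")
    case True
    have zero: "pochhammer (- real j) (n + 1) = 0" using True by (intro pochhammer_of_nat_eq_0_lemma) simp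
    have eq: "(-1) ^ j * poly (numer D (Suc n)) (- real j) =
        (real n + 2 - real j) * ((-1) ^ j * poly (numer D n) (- real j))"
      unfolding poly_numer_Suc zero by simp
    show ?thesis unfolding eq by (intro mult_pos_pos Suc.IH) (use True in auto)
  next
    case False
    then have j: "j = n + 1" using Suc.prems by simp
    have "(D + n) choose n < (D + n + 1) choose (n + 1)"
      using assms(1) by simp
    then have "real ((D + n) choose n) < real ((D + n + 1) choose (n + 1))" by (simp only: of_nat_less_iff)
    then have "0 < (real ((D + n + 1) choose (n + 1)) - real ((D + n) choose n)) * fact (n + 1)"
      by (intro mult_pos_pos) (simp_all del: binomial_Suc_Suc fact_Suc)
    also have "\<dots> = (-1) ^ j * poly (numer D (Suc n)) (- real j)"
      unfolding j poly_numer_Suc poly_numer_boundary pochhammer_neg_same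
      by (simp add: algebra_simps del: binomial_Suc_Suc fact_Suc)
    finally show ?thesis .
  qed
qed simp

text \<open>At a root of \<open>numer (d + 1) n\<close> this expresses \<open>numer d n\<close> by a rising factorial, whose sign is
  known.\<close>

lemma numer_rank_recurrence:
  "real d * poly (numer (d + 1) n) x =
     (real d - x) * poly (numer d n) x + real ((d + n + 1) choose n) * pochhammer x (n + 1)"
proof (induction n)
  case (Suc n)
  define A B where "A = real ((d + n + 1) choose n)" and "B = real ((d + n + 1) choose (n + 1))"
  have AB: "real ((d + 1 + n + 1) choose (n + 1)) = A + B" "real ((d + Suc n + 1) choose Suc n) = A + B"
    by (simp_all add: A_def B_def)
  have "(n + 1) * ((d + n + 1) choose (n + 1)) = (d + 1) * ((d + n + 1) choose n)"
    using binomial_absorb_comp[of "d + n + 1" n] binomial_absorption[of n "d + n + 1"]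
    by (simp del: binomial_Suc_Suc)
  then have rel: "(real n + 1) * B = (real d + 1) * A"
    unfolding A_def B_def by (metis of_nat_mult of_nat_add of_nat_1)
  let ?P = "pochhammer x (n + 1)"
  have "real d * poly (numer (d + 1) (Suc n)) x =
      (real n + 2 + x) * (real d * poly (numer (d + 1) n) x) + real d * (A + B) * ?P"
    unfolding poly_numer_Suc AB by (simp add: algebra_simps)
  also have "\<dots> = (real d - x) * ((real n + 2 + x) * poly (numer d n) x + B * ?P) +
      ((real n + 2 + x) * A + real d * (A + B) - (real d - x) * B) * ?P"
    unfolding Suc.IH A_def[symmetric] by (simp add: algebra_simps)
  also have "(real n + 2 + x) * A + real d * (A + B) - (real d - x) * B = (A + B) * (x + real (n + 1))"
    using rel by (simp add: algebra_simps)
  finally show ?case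
    unfolding poly_numer_Suc AB B_def[symmetric] by (simp add: pochhammer_Suc mult_ac)
qed simp

lemma pochhammer_sign:
  fixes x :: real
  assumes "x < - real j" "- real (j + 1) < x" "j \<le> n"
  shows "(-1) ^ (j + 1) * pochhammer x (n + 1) > 0"
proof -
  have "(-1) ^ k * pochhammer x k > 0" if "k \<le> j + 1" for k
    using that
  proof (induction k)
    case (Suc k)
    have "- (x + real k) > 0" using Suc.prems assms(1) by simp
    then have "0 < (- (x + real k)) * ((-1) ^ k * pochhammer x k)"
      using Suc by (intro mult_pos_pos[of "- (x + real k)"]) auto
    also have "(- (x + real k)) * ((-1) ^ k * pochhammer x k) = (-1) ^ Suc k * pochhammer x (Suc k)"
      by (simp add: pochhammer_Suc algebra_simps)
    finally show ?case .
  qed simp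
  moreover have "pochhammer (x + real (j + 1)) (n - j) > 0" using assms by (intro pochhammer_pos) simp
  moreover have "pochhammer x (n + 1) = pochhammer x (j + 1) * pochhammer (x + real (j + 1)) (n - j)"
    using pochhammer_product'[of x "j + 1" "n - j"] assms(3) by simp
  ultimately show ?thesis by (metis le_refl mult.assoc mult_pos_pos)
qed

text \<open>The multiplier of rank \<open>d + 1\<close> alternates at \<open>0, -1, \<dots>, -n\<close>, so it has one root in each gap. At
  such a root, the recurrence in the rank determines the sign of the multiplier of rank \<open>d\<close>.\<close>

lemma numer_roots:
  assumes "d \<ge> 1"
  obtains S a where "finite S" "card S = n" "\<And>\<rho>. \<rho> \<in> S \<Longrightarrow> \<rho> > 0" "a > 0"
    "numer (d + 1) n = smult a (\<Prod>\<rho>\<in>S. [:\<rho>, 1:])"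
    "\<And>\<rho>. \<rho> \<in> S \<Longrightarrow> poly (numer d n) (- \<rho>) * poly (pderiv (numer (d + 1) n)) (- \<rho>) > 0"
proof -
  let ?N = "numer (d + 1) n"
  have "\<exists>x. - real (j + 1) < x \<and> x < - real j \<and> poly ?N x = 0" if "j < n" for j
  proof -
    have "(-1) ^ j * poly ?N (- real j) > 0" "(-1) ^ (j + 1) * poly ?N (- real (j + 1)) > 0"
      using numer_alternates[of "d + 1" j n] numer_alternates[of "d + 1" "j + 1" n] that by auto
    then have "poly ?N (- real (j + 1)) * poly ?N (- real j) < 0"
      by (cases "even j") (auto simp: mult_less_0_iff)
    then show ?thesis using poly_IVT[of "- real (j + 1)" "- real j" ?N] by auto
  qed
  then obtain h where h: "\<And>j. j < n \<Longrightarrow> - real (j + 1) < h j \<and> h j < - real j \<and> poly ?N (h j) = 0"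
    by metis
  have sep: "i = j" if "i < n" "- real (j + 1) < h i" "h i < - real j" for i j
    using h[OF that(1)] that by simp
  have inj: "inj_on h {..<n}"
    by (rule inj_onI) (use sep h in force)
  have deg: "degree ?N = n"
    using degree_numer[of "d + 1" n] coeff_numer_pos[of "d + 1" n] le_degree[of ?N n] by auto
  have nz: "?N \<noteq> 0" using coeff_numer_pos[of "d + 1" n] by auto
  have card: "card (h ` {..<n}) = n" using card_image[OF inj] by simp
  have roots: "{x. poly ?N x = 0} = h ` {..<n}"
  proof (rule card_subset_eq[symmetric])
    show "finite {x. poly ?N x = 0}" using nz by (rule poly_roots_finite)
    then have "card (h ` {..<n}) \<le> card {x. poly ?N x = 0}" using h by (intro card_mono) auto
    then show "card (h ` {..<n}) = card {x. poly ?N x = 0}"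
      using card_poly_roots_bound[OF nz] card deg by simp
  qed (use h in auto)
  let ?S = "uminus ` h ` {..<n}"
  have inj': "inj_on uminus (h ` {..<n})" by (simp add: inj_on_def)
  show ?thesis
  proof (rule that[of ?S "lead_coeff ?N"])
    show "finite ?S" "card ?S = n" using card card_image[OF inj'] by simp_all
    show "\<rho> > 0" if "\<rho> \<in> ?S" for \<rho> using that h by force
    show "lead_coeff ?N > 0" using deg coeff_numer_pos by simp
    have "?N = smult (lead_coeff ?N) (\<Prod>z\<in>h ` {..<n}. [:-z, 1:])"
      using roots card deg by (intro eq_prod_roots) auto
    also have "(\<Prod>z\<in>h ` {..<n}. [:-z, 1:]) = (\<Prod>\<rho>\<in>?S. [:\<rho>, 1:])"
      by (simp add: prod.reindex[OF inj'])
    finally show "?N = smult (lead_coeff ?N) (\<Prod>\<rho>\<in>?S. [:\<rho>, 1:])" .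
    fix \<rho> assume "\<rho> \<in> ?S"
    then obtain j where j: "j < n" "\<rho> = - h j" by auto
    define x where "x = h j"
    have x: "- real (j + 1) < x" "x < - real j" "poly ?N x = 0" using h[OF j(1)] by (auto simp: x_def)
    have N: "(-1) ^ j * poly ?N (- real j) > 0" using numer_alternates[of "d + 1" j n] j by simp
    \<comment> \<open>Without a further root up to \<open>- j\<close>, the derivative at \<open>x\<close> has the sign of the value at \<open>- j\<close>.\<close>
    have gap: "poly ?N y \<noteq> 0" if "x < y" "y \<le> - real j" for y
    proof
      assume "poly ?N y = 0"
      then obtain i where i: "i < n" "y = h i" using roots by blast
      have "y \<noteq> - real j" using N \<open>poly ?N y = 0\<close> by auto
      then have "i = j" using sep[of i j] i that x by simp
      then show False using i that by (simp add: x_def)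
    qed
    have "poly ?N (- real j) * poly (pderiv ?N) x > 0"
    proof (rule sign_right_of_root)
      show "poly (pderiv ?N) x \<noteq> 0"
        using nz roots card deg x by (intro pderiv_nz_at_root) auto
    qed (use x gap in auto)
    then have d1: "(-1) ^ j * poly (pderiv ?N) x > 0"
      using N by (cases "even j") (auto simp: zero_less_mult_iff mult_less_0_iff)
    have "(real d - x) * poly (numer d n) x = - real ((d + n + 1) choose n) * pochhammer x (n + 1)"
      using numer_rank_recurrence[of d n x] x(3) by simp
    from arg_cong[OF this, of "\<lambda>t. (-1) ^ j * t"]
    have "(real d - x) * ((-1) ^ j * poly (numer d n) x) =
        real ((d + n + 1) choose n) * ((-1) ^ (j + 1) * pochhammer x (n + 1))"
      by (simp add: mult_ac del: binomial_Suc_Suc)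
    also have "\<dots> > 0"
      using mult_pos_pos[OF _ pochhammer_sign[OF x(2,1) less_imp_le[OF j(1)]],
        of "real ((d + n + 1) choose n)"] by (simp del: binomial_Suc_Suc)
    finally have d2: "(-1) ^ j * poly (numer d n) x > 0" using x by (auto simp: zero_less_mult_iff)
    have "poly (numer d n) x * poly (pderiv ?N) x > 0"
      using d1 d2 by (cases "even j") (auto simp: zero_less_mult_iff)
    then show "poly (numer d n) (- \<rho>) * poly (pderiv ?N) (- \<rho>) > 0" using j by (simp add: x_def)
  qed
qed

section \<open>Interlacing of the gamma polynomials\<close>

definition gamma_poly :: "nat \<Rightarrow> nat \<Rightarrow> real poly" where
  "gamma_poly n D = diag (numer D n) (gegenbauer n D)"

lemma coeff_gamma_poly:
  "coeff (gamma_poly n D) i = (if i \<le> D div 2 then gamma_coeff n D i else 0)"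
proof -
  have "i \<le> D div 2 \<longleftrightarrow> 2 * i \<le> D" by auto
  then show ?thesis by (simp add: gamma_poly_def coeff_gegenbauer gamma_coeff_def del: fact_Suc)
qed

lemma gamma_coeff_pos: "gamma_coeff n D i > 0"
  using poly_numer_pos[of "real i" D n] by (simp add: gamma_coeff_def)

lemma degree_gamma_poly: "degree (gamma_poly n D) = D div 2"
proof (rule antisym)
  show "degree (gamma_poly n D) \<le> D div 2" by (rule degree_le) (auto simp: coeff_gamma_poly)
  show "D div 2 \<le> degree (gamma_poly n D)"
    by (rule le_degree) (use gamma_coeff_pos[of n D "D div 2"] in \<open>simp add: coeff_gamma_poly\<close>)
qed

text \<open>The step from rank \<open>d + 1\<close> down to rank \<open>d\<close> of the Gegenbauer polynomials is itself a diagonal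
  operator with a linear multiplier, so both gamma polynomials arise from the same polynomial by
  diagonal operators.\<close>

lemma gamma_poly_interlacing:
  assumes "d \<ge> 1"
  shows "neg_simple (gamma_poly n (d + 1))"
    and "poly (gamma_poly n (d + 1)) z = 0 \<Longrightarrow>
      poly (gamma_poly n d) z * poly (pderiv (gamma_poly n (d + 1))) z > 0"
proof -
  let ?f = "gegenbauer n (d + 1)" and ?L = "[:1, - 2 / real (d + 1):]"
  obtain S a where S: "finite S" "card S = n" "\<And>\<rho>. \<rho> \<in> S \<Longrightarrow> \<rho> > 0" and a: "a > 0"
    and N: "numer (d + 1) n = smult a (\<Prod>\<rho>\<in>S. [:\<rho>, 1:])"
    and sign: "\<And>\<rho>. \<rho> \<in> S \<Longrightarrow> poly (numer d n) (- \<rho>) * poly (pderiv (numer (d + 1) n)) (- \<rho>) > 0"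
    using numer_roots[OF assms, of n] by blast
  show "neg_simple (gamma_poly n (d + 1))"
    unfolding gamma_poly_def N diag_smult
    using S a by (intro neg_simple_smult neg_simple_diag_prod neg_simple_gegenbauer) auto
  define R where "R = numer d n * ?L"
  have R: "gamma_poly n d = diag R ?f"
    using gegenbauer_lower[of "d + 1" n] by (simp only: gamma_poly_def R_def diag_mult) simp
  show "poly (gamma_poly n d) z * poly (pderiv (gamma_poly n (d + 1))) z > 0"
    if "poly (gamma_poly n (d + 1)) z = 0"
    unfolding R gamma_poly_def[of n "d + 1"] N
  proof (rule diag_interlacing_sign[OF neg_simple_gegenbauer S(1,3) a])
    have "degree R \<le> degree (numer d n) + degree ?L" unfolding R_def by (rule degree_mult_le)
    then show "degree R \<le> card S + 1" using degree_numer[of d n] S(2) by simp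
    have "coeff R (n + 1) = - 2 / real (d + 1) * coeff (numer d n) n"
      using degree_numer[of d n] by (simp add: R_def coeff_eq_0)
    also have "\<dots> < 0" using coeff_numer_pos[of d n] by (intro mult_neg_pos) auto
    finally show "coeff R (card S + 1) < 0" using S(2) by simp
    show "poly R (- \<rho>) * poly (pderiv (smult a (\<Prod>\<rho>\<in>S. [:\<rho>, 1:]))) (- \<rho>) > 0" if "\<rho> \<in> S" for \<rho>
    proof -
      have "poly ?L (- \<rho>) > 0" using S(3)[OF that] by (simp add: add_pos_pos)
      then have "poly ?L (- \<rho>) * (poly (numer d n) (- \<rho>) * poly (pderiv (numer (d + 1) n)) (- \<rho>)) > 0"
        using sign[OF that] by (rule mult_pos_pos)
      then show ?thesis unfolding N by (simp only: R_def poly_mult mult_ac)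
    qed
    show "poly (diag (smult a (\<Prod>\<rho>\<in>S. [:\<rho>, 1:])) ?f) z = 0"
      using that unfolding gamma_poly_def N .
  qed
qed

section \<open>From the gamma polynomials to the Z-polynomials\<close>

lemma poly_zeta:
  assumes "x \<noteq> -1"
  shows "poly (zeta n D) x = (1 + x) ^ D * poly (gamma_poly n D) (x / (1 + x)\<^sup>2)"
proof -
  have x: "1 + x \<noteq> 0" using assms by linarith
  have "poly (zeta n D) x = (\<Sum>i\<le>D div 2. gamma_coeff n D i * (x ^ i * (1 + x) ^ (D - 2 * i)))"
    by (simp add: zeta_def poly_sum poly_monom)
  also have "\<dots> = (\<Sum>i\<le>D div 2. (1 + x) ^ D * (coeff (gamma_poly n D) i * (x / (1 + x)\<^sup>2) ^ i))"
  proof (rule sum.cong[OF refl])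
    fix i assume "i \<in> {..D div 2}"
    then have i: "i \<le> D div 2" "D = (D - 2 * i) + 2 * i" by auto
    have "(1 + x) ^ D = (1 + x) ^ (D - 2 * i) * ((1 + x)\<^sup>2) ^ i"
      by (subst i(2)) (simp only: power_add power_mult)
    then have "x ^ i * (1 + x) ^ (D - 2 * i) = (1 + x) ^ D * (x / (1 + x)\<^sup>2) ^ i"
      using x by (simp add: power_divide)
    then show "gamma_coeff n D i * (x ^ i * (1 + x) ^ (D - 2 * i)) =
        (1 + x) ^ D * (coeff (gamma_poly n D) i * (x / (1 + x)\<^sup>2) ^ i)"
      using i by (simp add: coeff_gamma_poly)
  qed
  also have "\<dots> = (1 + x) ^ D * poly (gamma_poly n D) (x / (1 + x)\<^sup>2)"
    by (simp add: poly_altdef degree_gamma_poly sum_distrib_left)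
  finally show ?thesis .
qed

lemma degree_zeta: "degree (zeta n D) = D"
  using coeff_zeta_above[of D] coeff_zeta_top[of n D]
  by (intro antisym degree_le le_degree) auto

lemma zeta_even_at_minus_1:
  assumes "D = 2 * t"
  shows "poly (zeta n D) (-1) = gamma_coeff n D t * (-1) ^ t"
proof -
  have "poly (zeta n D) (-1) = (\<Sum>i\<le>t. if i = t then gamma_coeff n D t * (-1) ^ t else 0)"
    unfolding zeta_def poly_sum assms by (rule sum.cong) (auto simp: poly_monom)
  then show ?thesis by simp
qed

lemma zeta_odd_factor:
  assumes "D = 2 * t + 1"
  obtains g where "zeta n D = [:1, 1:] * g" "poly g (-1) = gamma_coeff n D t * (-1) ^ t"
proof (rule that)
  let ?g = "\<Sum>i\<le>t. smult (gamma_coeff n D i) (monom 1 i * [:1, 1:] ^ (2 * t - 2 * i))"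
  show "zeta n D = [:1, 1:] * ?g"
    unfolding zeta_def sum_distrib_left
  proof (rule sum.cong)
    fix i assume "i \<in> {..t}"
    then have "D - 2 * i = Suc (2 * t - 2 * i)" using assms by auto
    then show "smult (gamma_coeff n D i) (monom 1 i * [:1, 1:] ^ (D - 2 * i)) =
        [:1, 1:] * smult (gamma_coeff n D i) (monom 1 i * [:1, 1:] ^ (2 * t - 2 * i))"
      by (simp only: power_Suc mult_smult_right mult_smult_left mult_ac)
  qed (simp add: assms)
  have "poly ?g (-1) = (\<Sum>i\<le>t. if i = t then gamma_coeff n D t * (-1) ^ t else 0)"
    unfolding poly_sum by (rule sum.cong) (auto simp: poly_monom)
  then show "poly ?g (-1) = gamma_coeff n D t * (-1) ^ t" by simp
qed

lemma koebe_preimage: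
  fixes z :: real
  assumes "z < 0"
  shows "\<exists>x. -1 < x \<and> x < 0 \<and> x / (1 + x)\<^sup>2 = z"
proof -
  let ?q = "[:z, 2 * z - 1, z:]"
  obtain x where x: "-1 < x" "x < 0" "poly ?q x = 0"
    using poly_IVT_neg[of "-1" 0 ?q] assms by (auto simp: algebra_simps)
  then have "x = z * (1 + x)\<^sup>2" by (simp add: power2_eq_square algebra_simps)
  then show ?thesis using x by (intro exI[of _ x]) (simp add: divide_eq_eq)
qed

text \<open>Each root \<open>z\<close> of the gamma polynomial gives two roots \<open>x\<close> and \<open>1/x\<close>; for odd rank, there is the
  additional root \<open>-1\<close>.\<close>

lemma card_roots_zeta:
  assumes neg: "neg_simple (gamma_poly n D)"
  shows "card {x. poly (zeta n D) x = 0} = D"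
proof -
  define R where "R = {x. x < 0 \<and> poly (gamma_poly n D) x = 0}"
  have R: "finite R" "card R = D div 2"
    using neg neg_simple_facts(2)[OF neg] by (auto simp: R_def neg_simple_def degree_gamma_poly)
  obtain \<xi> where \<xi>: "\<And>z. z \<in> R \<Longrightarrow> -1 < \<xi> z \<and> \<xi> z < 0 \<and> \<xi> z / (1 + \<xi> z)\<^sup>2 = z"
    using koebe_preimage unfolding R_def by (metis mem_Collect_eq)
  have root: "poly (zeta n D) x = 0" if "x \<noteq> -1" "x / (1 + x)\<^sup>2 \<in> R" for x
    using that by (simp add: poly_zeta R_def)
  define A where "A = \<xi> ` R"
  define B where "B = inverse ` A"
  define C where "C = (if odd D then {-1 :: real} else {})"
  have inj: "inj_on \<xi> R" by (rule inj_onI) (metis \<xi>)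
  have A: "finite A" "card A = D div 2" "\<And>x. x \<in> A \<Longrightarrow> -1 < x \<and> x < 0"
    using R \<xi> card_image[OF inj] by (auto simp: A_def)
  have B: "finite B" "card B = D div 2"
    using A by (auto simp: B_def card_image inj_on_def)
  have Blt: "y < -1" if "y \<in> B" for y
  proof -
    obtain x where "x \<in> A" "y = inverse x" using \<open>y \<in> B\<close> by (auto simp: B_def)
    then show ?thesis using A(3)[of x] one_less_inverse[of "- x"] by simp
  qed
  have "card (A \<union> B \<union> C) = card A + card B + card C"
    using A B Blt by (subst card_Un_disjoint, force simp: C_def, force simp: C_def, force simp: C_def)
      (subst card_Un_disjoint; force)
  also have "\<dots> = D"
    using A B by (simp add: C_def) presburger
  finally have card: "card (A \<union> B \<union> C) = D" .
  have sub: "A \<union> B \<union> C \<subseteq> {x. poly (zeta n D) x = 0}"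
  proof -
    have "poly (zeta n D) x = 0 \<and> poly (zeta n D) (inverse x) = 0" if "x \<in> A" for x
    proof -
      obtain z where z: "z \<in> R" "x = \<xi> z" using \<open>x \<in> A\<close> by (auto simp: A_def)
      have x: "-1 < x" "x < 0" "x / (1 + x)\<^sup>2 = z" using \<xi>[OF z(1)] z by auto
      have nz: "1 + x \<noteq> 0" using x by linarith
      have "inverse x \<noteq> -1" using x by (simp add: field_simps)
      moreover have "inverse x / (1 + inverse x)\<^sup>2 = x / (1 + x)\<^sup>2"
      proof -
        have "1 + inverse x = (1 + x) / x" using x by (simp add: field_simps)
        then show ?thesis using x nz by (simp add: power2_eq_square field_simps)
      qed
      ultimately show ?thesis using root[of x] root[of "inverse x"] x z by simp
    qed
    moreover have "poly (zeta n D) (-1) = 0" if "odd D"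
    proof -
      obtain t where "D = 2 * t + 1" using \<open>odd D\<close> by (rule oddE)
      then obtain g where "zeta n D = [:1, 1:] * g" by (rule zeta_odd_factor)
      then show ?thesis by simp
    qed
    ultimately show ?thesis by (auto simp: B_def C_def split: if_splits)
  qed
  have nz: "zeta n D \<noteq> 0" using coeff_zeta_top[of n D] by auto
  have "card (A \<union> B \<union> C) \<le> card {x. poly (zeta n D) x = 0}"
    using sub poly_roots_finite[OF nz] by (rule card_mono[rotated])
  then show ?thesis using card card_poly_roots_bound[OF nz] by (simp add: degree_zeta)
qed

text \<open>With \<open>y = b / (1 + b)\<^sup>2\<close>, the sign at \<open>b \<noteq> -1\<close> is inherited from the gamma polynomials at \<open>y\<close>: the
  remaining factors \<open>(1 + b)\<^sup>d\<close> and \<open>(1 + b)\<^bsup>d + 1\<^esup> (1 - b) / (1 + b)\<^sup>3\<close>, the latter including the derivative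
  of \<open>y\<close>, multiply to a square times \<open>1 - b > 0\<close>. At \<open>-1\<close> only the leading coefficients of
  the gamma polynomials remain.\<close>

lemma zeta_interlacing_sign:
  assumes d: "d \<ge> 1" and b: "poly (zeta n (d + 1)) b = 0"
  shows "poly (zeta n d) b * poly (pderiv (zeta n (d + 1))) b > 0"
proof (cases "b = -1")
  case True
  have "odd (d + 1)"
  proof
    assume "even (d + 1)"
    then obtain t where "d + 1 = 2 * t" by (rule evenE)
    then show False
      using zeta_even_at_minus_1[of "d + 1" t n] b True gamma_coeff_pos[of n "d + 1" t] by simp
  qed
  then obtain t where t: "d + 1 = 2 * t + 1" by (rule oddE)
  then obtain g where g: "zeta n (d + 1) = [:1, 1:] * g" "poly g (-1) = gamma_coeff n (d + 1) t * (-1) ^ t"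
    by (rule zeta_odd_factor)
  have "poly (pderiv (zeta n (d + 1))) b = gamma_coeff n (d + 1) t * (-1) ^ t"
    unfolding g(1) True using poly_pderiv_linear_mult[of 1 g] g(2) by simp
  moreover have "poly (zeta n d) b = gamma_coeff n d t * (-1) ^ t"
    unfolding True using t by (intro zeta_even_at_minus_1) simp
  ultimately have "poly (zeta n d) b * poly (pderiv (zeta n (d + 1))) b =
      gamma_coeff n d t * gamma_coeff n (d + 1) t * ((-1) ^ t * (-1) ^ t)" by simp
  then show ?thesis using gamma_coeff_pos[of n] by simp
next
  case False
  let ?g = "gamma_poly n (d + 1)" and ?y = "b / (1 + b)\<^sup>2"
  have nz: "1 + b \<noteq> 0" using False by linarith
  have y: "poly ?g ?y = 0" using b nz by (simp add: poly_zeta[OF False])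
  have "?y < 0" using neg_simple_facts(4)[OF gamma_poly_interlacing(1)[OF d] y] .
  then have b0: "b < 0" by (simp add: divide_less_0_iff)
  have der: "((\<lambda>x. (1 + x) ^ (d + 1) * poly ?g (x / (1 + x)\<^sup>2)) has_real_derivative
      (1 + b) ^ (d + 1) * (poly (pderiv ?g) ?y * ((1 - b) / (1 + b) ^ 3))) (at b)"
  proof -
    have quot: "((\<lambda>x. x / (1 + x)\<^sup>2) has_real_derivative (1 - b) / (1 + b) ^ 3) (at b)"
    proof -
      have "((\<lambda>x. x / (1 + x)\<^sup>2) has_real_derivative
          (1 * (1 + b)\<^sup>2 - b * (2 * (1 + b))) / ((1 + b)\<^sup>2 * (1 + b)\<^sup>2)) (at b)"
        using nz by (auto intro!: derivative_eq_intros)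
      moreover have "(1 * (1 + b)\<^sup>2 - b * (2 * (1 + b))) / ((1 + b)\<^sup>2 * (1 + b)\<^sup>2) = (1 - b) / (1 + b) ^ 3"
      proof -
        have "1 * (1 + b)\<^sup>2 - b * (2 * (1 + b)) = (1 + b) * (1 - b)"
          by (simp add: power2_eq_square algebra_simps)
        moreover have "(1 + b)\<^sup>2 * (1 + b)\<^sup>2 = (1 + b) * (1 + b) ^ 3"
          by (simp add: power2_eq_square power3_eq_cube)
        ultimately show ?thesis using nz by simp
      qed
      ultimately show ?thesis by simp
    qed
    have outer: "((\<lambda>x. poly ?g (x / (1 + x)\<^sup>2)) has_real_derivative
        poly (pderiv ?g) ?y * ((1 - b) / (1 + b) ^ 3)) (at b)"
      by (rule DERIV_chain2[OF poly_DERIV quot])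
    have power: "((\<lambda>x. (1 + x) ^ (d + 1)) has_real_derivative
        real (d + 1) * (1 + b) ^ d) (at b)"
    proof -
      have "((\<lambda>x. 1 + x) has_real_derivative 1) (at b)" by (auto intro!: derivative_eq_intros)
      from DERIV_chain2[OF DERIV_pow[of "d + 1"] this] show ?thesis by simp
    qed
    show ?thesis by (rule DERIV_cong[OF DERIV_mult[OF power outer]]) (use y in simp)
  qed
  have "(poly (zeta n (d + 1)) has_real_derivative
      (1 + b) ^ (d + 1) * (poly (pderiv ?g) ?y * ((1 - b) / (1 + b) ^ 3))) (at b)"
    by (rule has_field_derivative_transform_within_open[OF der, of "- {-1}"])
      (use False in \<open>auto simp: poly_zeta\<close>)
  then have "poly (pderiv (zeta n (d + 1))) b =
      (1 + b) ^ (d + 1) * (poly (pderiv ?g) ?y * ((1 - b) / (1 + b) ^ 3))"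
    using poly_DERIV DERIV_unique by blast
  then have "poly (zeta n d) b * poly (pderiv (zeta n (d + 1))) b =
      ((1 + b) ^ d * (1 + b) ^ (d + 1) / (1 + b) ^ 3) * (1 - b) *
      (poly (gamma_poly n d) ?y * poly (pderiv ?g) ?y)"
    by (simp add: poly_zeta[OF False])
  also have "(1 + b) ^ d * (1 + b) ^ (d + 1) / (1 + b) ^ 3 = ((1 + b) ^ (d - 1))\<^sup>2"
  proof -
    have "(1 + b) ^ d * (1 + b) ^ (d + 1) = ((1 + b) ^ (d - 1))\<^sup>2 * (1 + b) ^ 3"
      using d by (cases d) (simp_all add: power2_eq_square power3_eq_cube mult_ac)
    then show ?thesis using nz by simp
  qed
  also have "((1 + b) ^ (d - 1))\<^sup>2 * (1 - b) * (poly (gamma_poly n d) ?y * poly (pderiv ?g) ?y) > 0"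
    by (rule mult_pos_pos[OF mult_pos_pos gamma_poly_interlacing(2)[OF d y]]) (use nz b0 in auto)
  finally show ?thesis .
qed

section \<open>A criterion for strict interlacing\<close>

lemma sorted_splice:
  fixes as bs :: "real list"
  assumes "length bs = length as + 1"
    and "\<And>i. i < length as \<Longrightarrow> bs ! i < as ! i \<and> as ! i < bs ! (i + 1)"
  shows "sorted_wrt (<) (splice bs as) \<and> hd (splice bs as) = hd bs"
  using assms
proof (induction as arbitrary: bs)
  case Nil
  then obtain b where "bs = [b]" by (cases bs) auto
  then show ?case by simp
next
  case (Cons a as)
  then obtain b c bs' where bs: "bs = b # c # bs'"
    by (metis length_Cons Suc_eq_plus1 length_Suc_conv)
  have "sorted_wrt (<) (splice (c # bs') as) \<and> hd (splice (c # bs') as) = hd (c # bs')"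
  proof (rule Cons.IH)
    show "length (c # bs') = length as + 1" using Cons.prems(1) bs by simp
    show "(c # bs') ! i < as ! i \<and> as ! i < (c # bs') ! (i + 1)" if "i < length as" for i
      using Cons.prems(2)[of "Suc i"] that bs by simp
  qed
  moreover have "b < a" "a < c" using Cons.prems(2)[of 0] bs by auto
  moreover obtain ys where ys: "splice (c # bs') as = c # ys"
    using calculation(1) by (cases as) auto
  ultimately show ?case unfolding bs by (auto dest: less_trans)
qed

lemma proots_simple:
  fixes f :: "real poly"
  assumes "f \<noteq> 0" "finite Z" "Z \<subseteq> {x. poly f x = 0}" "card Z = degree f"
  shows "proots f = mset_set Z"
proof -
  have "f = smult (lead_coeff f) (\<Prod>z\<in>Z. [:-z, 1:])" using assms by (intro eq_prod_roots)
  then have "proots f = proots (smult (lead_coeff f) (\<Prod>z\<in>Z. [:-z, 1:]))" by simp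
  also have "\<dots> = (\<Sum>z\<in>Z. {#z#})" using assms(1) by (simp add: proots_prod)
  also have "\<dots> = mset_set Z" by simp
  finally show ?thesis .
qed

text \<open>The sign condition makes \<open>p\<close> change sign between consecutive roots of \<open>q\<close>, and the roots of \<open>p\<close>
  found there exhaust its degree.\<close>

lemma strictly_interlaces_criterion:
  assumes deg: "degree q = degree p + 1" and lead: "lead_coeff p > 0" "lead_coeff q > 0"
    and roots: "card {x. poly q x = 0} = degree q"
    and sign: "\<And>x. poly q x = 0 \<Longrightarrow> poly p x * poly (pderiv q) x > 0"
  shows "p \<prec> q"
proof -
  define B where "B = {x. poly q x = 0}"
  define bs where "bs = sorted_list_of_set B"
  define n where "n = degree p"
  have nz: "p \<noteq> 0" "q \<noteq> 0" using lead by auto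
  have B: "finite B" "card B = n + 1"
    using poly_roots_finite[OF nz(2)] roots deg by (auto simp: B_def n_def)
  have bs: "length bs = n + 1" "set bs = B" "sorted_wrt (<) bs"
    using B by (auto simp: bs_def)
  have mono: "bs ! i < bs ! j \<longleftrightarrow> i < j" if "i \<le> n" "j \<le> n" for i j
    using bs(1,3) that sorted_wrt_nth_less[of "(<)" bs] by (metis Suc_eq_plus1 le_imp_less_Suc less_asym linorder_neqE_nat less_irrefl)
  have "\<exists>w. bs ! i < w \<and> w < bs ! (i + 1) \<and> poly p w = 0" if i: "i < n" for i
  proof (rule root_between_consecutive_roots[of q])
    have mem: "bs ! i \<in> B" "bs ! (i + 1) \<in> B" using bs i by (auto simp flip: bs(2))
    then show "poly q (bs ! i) = 0" "poly q (bs ! (i + 1)) = 0" by (auto simp: B_def)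
    then have "poly p (bs ! i) * poly (pderiv q) (bs ! i) > 0"
      "poly p (bs ! (i + 1)) * poly (pderiv q) (bs ! (i + 1)) > 0" by (auto intro: sign)
    then show "(poly p (bs ! i) * poly (pderiv q) (bs ! i)) *
      (poly p (bs ! (i + 1)) * poly (pderiv q) (bs ! (i + 1))) > 0"
      "poly (pderiv q) (bs ! i) \<noteq> 0" "poly (pderiv q) (bs ! (i + 1)) \<noteq> 0" by auto
    show "bs ! i < bs ! (i + 1)" using mono[of i "i + 1"] i by simp
    show "poly q x \<noteq> 0" if "bs ! i < x" "x < bs ! (i + 1)" for x
    proof
      assume "poly q x = 0"
      then have "x \<in> set bs" using bs by (simp add: B_def)
      then obtain k where "k < length bs" "x = bs ! k" by (auto simp: in_set_conv_nth)
      then show False using mono[of i k] mono[of k "i + 1"] that i bs(1) by simp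
    qed
  qed
  then obtain a where a: "\<And>i. i < n \<Longrightarrow> bs ! i < a i \<and> a i < bs ! (i + 1) \<and> poly p (a i) = 0"
    by metis
  define as where "as = map a [0..<n]"
  have as: "length as = n" "\<And>i. i < n \<Longrightarrow> as ! i = a i" by (auto simp: as_def)
  have "sorted_wrt (<) as"
    unfolding sorted_wrt_iff_nth_less
  proof (intro allI impI)
    fix i j assume ij: "i < j" "j < length as"
    then have "a i < bs ! (i + 1)" "bs ! (i + 1) \<le> bs ! j" "bs ! j < a j"
      using a[of i] a[of j] mono[of j "i + 1"] as by (auto simp: not_less[symmetric])
    then show "as ! i < as ! j" using as ij by simp
  qed
  then have "sorted as" "distinct as"
    by (auto simp: strict_sorted_iff)
  have "proots p = mset_set (set as)"
  proof (rule proots_simple[OF nz(1)])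
    show "set as \<subseteq> {x. poly p x = 0}" using a by (auto simp: as_def)
    show "card (set as) = degree p" using as \<open>distinct as\<close> by (simp add: distinct_card n_def)
  qed simp
  then have sp: "sorted_roots p = as" "size (proots p) = degree p"
    using \<open>sorted as\<close> \<open>distinct as\<close> as
    by (simp_all add: sorted_roots_def sorted_list_of_set.idem_if_sorted_distinct distinct_card n_def)
  have "proots q = mset_set B"
    using B deg by (intro proots_simple[OF nz(2)]) (auto simp: B_def n_def)
  then have sq: "sorted_roots q = bs" "size (proots q) = degree q"
    using B deg by (simp_all add: sorted_roots_def bs_def n_def)
  have "sorted_wrt (<) (splice bs as)"
    using sorted_splice[of bs as] bs as a by simp
  then have chain: "sorted_wrt (<) (root_chain p q)" using deg sp sq by (simp add: root_chain_def)
  then have "sorted_wrt (\<le>) (root_chain p q)" by (simp add: strict_sorted_iff)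
  moreover have "\<not> (\<exists>x. poly p x = 0 \<and> poly q x = 0)" using sign by force
  ultimately show ?thesis
    using chain sp sq nz lead deg by (simp add: strictly_interlaces_def interlaces_def real_rooted_def)
qed

lemma zeta_strictly_interlaces:
  assumes "d \<ge> 1"
  shows "zeta n d \<prec> zeta n (d + 1)"
  using assms
  by (intro strictly_interlaces_criterion zeta_interlacing_sign)
    (simp_all add: degree_zeta coeff_zeta_top card_roots_zeta[OF gamma_poly_interlacing(1), simplified])

section \<open>Interlacing of the Z-polynomials\<close>

theorem theorem1p2:
  fixes m d :: nat
  assumes "m \<ge> 1" and "d \<ge> 1"
  shows "map_poly real_of_int (Z_poly (uniform_matroid m d)) \<prec>
         map_poly real_of_int (Z_poly (uniform_matroid m (d + 1)))"
proof -
  obtain n where m: "m = n + 1" using assms(1) by (metis Suc_eq_plus1 Suc_le_D One_nat_def)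
  have "real_poly (Z_poly (uniform_matroid m D)) = zeta n D" if "D \<ge> 1" for D
  proof (rule Z_poly_uniform_unique(2)[of "zeta n" "kl n"])
    show "coeff (zeta n d) i = coeff (zeta n d) (d - i)" if "i \<le> d" for d i
      using that by (rule coeff_zeta_palindromic)
    show "coeff (kl n d) i = 0" if "d \<ge> 1" "d \<le> 2 * i" for d i
      using that by (rule coeff_kl_upper)
    show "zeta n d = (\<Sum>k<d. smult (real ((n + 1 + d) choose k)) (monom 1 k * kl n (d - k))) + monom 1 d"
      if "d \<ge> 1" for d
      using that by (rule zeta_eq_kl_sum)
    show "is_uniform (n + 1) D (uniform_matroid m D)"
      unfolding m by (rule is_uniform_uniform_matroid)
  qed (rule that)
  then show ?thesis using zeta_strictly_interlaces[OF assms(2), of n] assms(2) by simp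
qed

end
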